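(* There is an absolute constant $C>0$ such that, for every $k$-armed bandit instance and every sufficiently large horizon $T$ (i.e. $T\ge T_0(k)$), the Modified NCB algorithm run with inputs $k$ and window $W=T$ (for $T$ rounds) satisfies $$\textsc{NR}_T\le C\sqrt{\frac{k\log T}{T}}.$$
   Context: Stochastic multi-armed bandit: there are $k$ arms; arm $i\in[k]$ is an unknown distribution supported on $[0,1]$ with mean $\mu_i$, and $\mu^*:=\max_{i\in[k]}\mu_i$. In each round an algorithm pulls an arm $I_t\in[k]$ and observes a reward drawn independently from the distribution of arm $I_t$. The Nash regret over $T$ rounds is $\textsc{NR}_T:=\mu^*-\big(\prod_{t=1}^T \mathbb{E}[\mu_{I_t}]\big)^{1/T}$. $\log$ is the natural logarithm. Modified NCB algorithm (inputs $k$ and window length $W$; constant $c=3$): maintain for each arm $i$ its pull count $n_i$ (initially $0$) and empirical mean $\widehat\mu_i$ (initially $0$); round index $t$ starts at $1$. Phase 1: while $\max_i n_i\widehat\mu_i\le 420c^2\log W$ and $t\le W$, pull an arm chosen uniformly at random from $[k]$ (independently of everything else), update, and increment $t$. Phase 2: while $t\le W$, pull an arm maximizing $$\overline{\mathrm{NCB}}_i:=\widehat\mu_i+2c\sqrt{\frac{2\widehat\mu_i\log W}{n_i}}$$ (ties arbitrary; if some $n_i=0$ the value may be defined arbitrarily), update, and increment $t$. *)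

theory Defs
  imports "HOL-Probability.Probability"
begin

text \<open>Arms are indexed by 0..k-1.  A history is the chronological list of
  (pulled arm, observed reward) pairs.\<close>

type_synonym hist = "(nat \<times> real) list"

definition cnt :: "hist \<Rightarrow> nat \<Rightarrow> nat" where
  "cnt h i = length (filter (\<lambda>p. fst p = i) h)"

definition rsum :: "hist \<Rightarrow> nat \<Rightarrow> real" where
  "rsum h i = sum_list (map snd (filter (\<lambda>p. fst p = i) h))"

definition muhat :: "hist \<Rightarrow> nat \<Rightarrow> real" where
  "muhat h i = (if cnt h i = 0 then 0 else rsum h i / real (cnt h i))"

definition ncb_c :: real where "ncb_c = 3"

text \<open>Modified NCB index with window W; for arms with n_i = 0 the value is
  arbitrary and supplied by the function v (which may depend on the history).\<close>
definition ncb :: "nat \<Rightarrow> (hist \<Rightarrow> nat \<Rightarrow> real) \<Rightarrow> hist \<Rightarrow> nat \<Rightarrow> real" where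
  "ncb W v h i = (if cnt h i = 0 then v h i
     else muhat h i + 2 * ncb_c * sqrt (2 * muhat h i * ln (real W) / real (cnt h i)))"

definition ncb_selector :: "nat \<Rightarrow> nat \<Rightarrow> (hist \<Rightarrow> nat \<Rightarrow> real) \<Rightarrow> (hist \<Rightarrow> nat) \<Rightarrow> bool" where
  "ncb_selector k W v sel \<longleftrightarrow>
     (\<forall>h. sel h < k \<and> (\<forall>j<k. ncb W v h j \<le> ncb W v h (sel h)))"

text \<open>State of the algorithm after t rounds: history and whether phase 2 has been
  entered.  Randomness: x (i, j) is the reward of the j-th pull (j counted from 0)
  of arm i ("reward table" model); u t is the uniform arm drawn in round t
  if round t is a phase-1 round.\<close>
primrec alg_state :: "nat \<Rightarrow> nat \<Rightarrow> (hist \<Rightarrow> nat \<Rightarrow> real) \<Rightarrow> (hist \<Rightarrow> nat)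
    \<Rightarrow> (nat \<times> nat \<Rightarrow> real) \<Rightarrow> (nat \<Rightarrow> nat) \<Rightarrow> nat \<Rightarrow> hist \<times> bool" where
  "alg_state k W v sel x u 0 = ([], False)"
| "alg_state k W v sel x u (Suc t) =
     (let (h, p2) = alg_state k W v sel x u t;
          p2' = (p2 \<or> \<not> (Max ((\<lambda>i. real (cnt h i) * muhat h i) ` {..<k})
                          \<le> 420 * ncb_c\<^sup>2 * ln (real W)));
          a = (if p2' then sel h else u (Suc t));
          r = x (a, cnt h a)
      in (h @ [(a, r)], p2'))"

text \<open>Arm pulled in round t (t \<ge> 1).\<close>
definition arm_at :: "nat \<Rightarrow> nat \<Rightarrow> (hist \<Rightarrow> nat \<Rightarrow> real) \<Rightarrow> (hist \<Rightarrow> nat)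
    \<Rightarrow> nat \<Rightarrow> (nat \<times> nat \<Rightarrow> real) \<times> (nat \<Rightarrow> nat) \<Rightarrow> nat" where
  "arm_at k W v sel t \<omega> = fst (last (fst (alg_state k W v sel (fst \<omega>) (snd \<omega>) t)))"

definition bandit_space :: "nat \<Rightarrow> nat \<Rightarrow> (nat \<Rightarrow> real measure)
    \<Rightarrow> ((nat \<times> nat \<Rightarrow> real) \<times> (nat \<Rightarrow> nat)) measure" where
  "bandit_space k T D =
     (PiM ({..<k} \<times> {..<T}) (\<lambda>ij. D (fst ij)))
       \<Otimes>\<^sub>M (PiM {1..T} (\<lambda>_. measure_pmf (pmf_of_set {..<k})))"

definition valid_instance :: "nat \<Rightarrow> (nat \<Rightarrow> real measure) \<Rightarrow> bool" where
  "valid_instance k D \<longleftrightarrow>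
     (\<forall>i<k. prob_space (D i) \<and> sets (D i) = sets borel \<and> measure (D i) {0..1} = 1)"

definition arm_mean :: "(nat \<Rightarrow> real measure) \<Rightarrow> nat \<Rightarrow> real" where
  "arm_mean D i = (\<integral>r. r \<partial>(D i))"

definition mu_star :: "nat \<Rightarrow> (nat \<Rightarrow> real measure) \<Rightarrow> real" where
  "mu_star k D = Max (arm_mean D ` {..<k})"

definition nash_regret :: "nat \<Rightarrow> nat \<Rightarrow> (nat \<Rightarrow> real measure)
    \<Rightarrow> (hist \<Rightarrow> nat \<Rightarrow> real) \<Rightarrow> (hist \<Rightarrow> nat) \<Rightarrow> real" where
  "nash_regret k T D v sel =
     mu_star k D -
     root T (\<Prod>t\<in>{1..T}. \<integral>\<omega>. arm_mean D (arm_at k T v sel t \<omega>) \<partial>(bandit_space k T D))"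

end

theory Submission
  imports Defs "HOL-Real_Asymp.Real_Asymp"
begin

text \<open>
  Write \<open>M\<close> for the best mean and \<open>L = ln T\<close>; we may assume \<open>M > sqrt (k L / T)\<close>, since the
  regret is at most \<open>M\<close>. Outside an event of probability at most \<open>4 k / T\<close>, which depends on the
  reward table and the uniform draws only, Chernoff bounds of width \<open>2 sqrt (2 L n M)\<close> hold for all
  partial sums of \<open>n \<ge> 800 L / M\<close> rewards, and the uniform draws are balanced. Then phase 1 ends
  between rounds \<open>1600 k L / M\<close> and \<open>10000 k L / M\<close>, and an arm pulled in phase 2 after \<open>n\<close>
  pulls has mean at least \<open>max (M/2) (M - 9 sqrt (2 L M / n))\<close>; summing over the rounds the total
  gap is \<open>O(sqrt (k L M T))\<close>.

  In an early round \<open>t\<close>, if the uniform draw happens to be the best arm, then the arm pulled has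
  mean at least \<open>M/2\<close> whichever phase the round belongs to. So the expected mean is at least
  \<open>M / (4 k)\<close>, and \<open>O(k L / M)\<close> such factors shift the geometric mean by
  \<open>O(k L ln (4 k) / T)\<close> only. In a late round the expected mean \<open>p\<close> is in \<open>[M/4, M]\<close>, where
  \<open>p / M \<ge> exp (- 4 (1 - p / M))\<close>, so the late factors are controlled by the expected total gap.
\<close>

subsection \<open>Chernoff bounds\<close>

text \<open>For negative \<open>y\<close> put z = -y: the product of 1 - z + z^2 with the Taylor
  polynomial 1 + z + z^2/2 \<le> exp z is at least 1, so 1 - z + z^2 dominates exp (-z).\<close>

lemma exp_le_quadratic:
  fixes y :: real
  assumes "\<bar>y\<bar> \<le> 1"
  shows "exp y \<le> 1 + y + y\<^sup>2"
proof (cases "y \<ge> 0")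
  case True
  then show ?thesis using assms exp_bound by simp
next
  case False
  define z where "z = - y"
  have z: "0 \<le> z" using False by (simp add: z_def)
  have pos: "0 < 1 - z + z\<^sup>2"
  proof -
    have "1 - z + z\<^sup>2 = (z - 1/2)\<^sup>2 + 3/4"
      by (simp add: power2_eq_square algebra_simps)
    then show ?thesis by (metis add_nonneg_pos zero_le_power2 zero_less_divide_iff zero_less_numeral)
  qed
  have "1 \<le> (1 - z + z\<^sup>2) * (1 + z + z\<^sup>2 / 2)"
  proof -
    have "(1 - z + z\<^sup>2) * (1 + z + z\<^sup>2 / 2) = 1 + z\<^sup>2 / 2 + z^3 / 2 + z^4 / 2"
      by (simp add: field_simps power2_eq_square power3_eq_cube power4_eq_xxxx)
    then show ?thesis using z by simp
  qed
  also have "\<dots> \<le> (1 - z + z\<^sup>2) * exp z"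
    using exp_lower_Taylor_quadratic[OF z] pos by (intro mult_left_mono) auto
  finally have "exp (- z) \<le> 1 - z + z\<^sup>2"
    by (simp add: exp_minus field_simps)
  then show ?thesis by (simp add: z_def)
qed

text \<open>On [0,1] the square of \<open>X\<close> is at most \<open>X\<close>, so the second-order
  term is controlled by the mean. The variance proxy is thus \<open>m\<close>, any upper bound on
  the mean, and deviations shrink with the size of the rewards.\<close>

lemma (in prob_space) exp_moment_le:
  fixes X :: "'a \<Rightarrow> real"
  assumes [measurable]: "random_variable borel X"
    and bd: "AE x in M. 0 \<le> X x \<and> X x \<le> 1"
    and m: "expectation X \<le> m" and s: "\<bar>s\<bar> \<le> 1"
  shows "integrable M (\<lambda>x. exp (s * X x))"
    and "expectation (\<lambda>x. exp (s * X x)) \<le> exp (s * expectation X + s\<^sup>2 * m)"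
proof -
  have intX: "integrable M X"
    using bd by (intro integrable_const_bound[where B = 1]) auto
  have ptw: "exp (s * y) \<le> 1 + s * y + s\<^sup>2 * y" if y: "0 \<le> y" "y \<le> 1" for y
  proof -
    have "\<bar>s * y\<bar> \<le> 1"
      using s y by (simp add: abs_mult mult_le_one)
    then have "exp (s * y) \<le> 1 + s * y + (s * y)\<^sup>2"
      by (rule exp_le_quadratic)
    also have "(s * y)\<^sup>2 \<le> s\<^sup>2 * y"
      using y by (auto simp: power_mult_distrib power2_eq_square[of y] intro!: mult_left_mono mult_left_le)
    finally show ?thesis by simp
  qed
  show int: "integrable M (\<lambda>x. exp (s * X x))"
  proof (rule integrable_const_bound[where B = "exp 1"])
    show "AE x in M. norm (exp (s * X x)) \<le> exp 1"
      using bd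
    proof eventually_elim
      case (elim x)
      have "s * X x \<le> \<bar>s\<bar> * \<bar>X x\<bar>" by (metis abs_ge_self abs_mult)
      also have "\<dots> \<le> 1" using s elim by (simp add: mult_le_one)
      finally show ?case by simp
    qed
  qed auto
  have "expectation (\<lambda>x. exp (s * X x)) \<le> expectation (\<lambda>x. 1 + s * X x + s\<^sup>2 * X x)"
  proof (intro integral_mono_AE int Bochner_Integration.integrable_add integrable_mult_right intX)
    show "AE x in M. exp (s * X x) \<le> 1 + s * X x + s\<^sup>2 * X x"
      using bd by eventually_elim (auto intro: ptw)
  qed auto
  also have "\<dots> = 1 + s * expectation X + s\<^sup>2 * expectation X"
    using intX by (simp add: prob_space)
  also have "\<dots> \<le> 1 + (s * expectation X + s\<^sup>2 * m)"
    using m by (simp add: mult_left_mono)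
  also have "\<dots> \<le> exp (s * expectation X + s\<^sup>2 * m)"
    by (rule exp_ge_add_one_self)
  finally show "expectation (\<lambda>x. exp (s * X x)) \<le> exp (s * expectation X + s\<^sup>2 * m)" .
qed

text \<open>Markov's inequality for exp (s * deviation), with \<open>s\<close> of either sign to
  serve both tails. For n variables the moment contributes exp (s^2 n m), the threshold exp (2 s^2 n
  m).\<close>

lemma (in prob_space) chernoff_signed:
  fixes X :: "'i \<Rightarrow> 'a \<Rightarrow> real"
  assumes fin: "finite J" and indep: "indep_vars (\<lambda>_. borel) X J"
    and bd: "\<And>j. j \<in> J \<Longrightarrow> AE x in M. 0 \<le> X j x \<and> X j x \<le> 1"
    and mean: "\<And>j. j \<in> J \<Longrightarrow> expectation (X j) = \<mu>"
    and m: "\<mu> \<le> m" and s: "\<bar>s\<bar> \<le> 1"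
  shows "prob {x \<in> space M. s * ((\<Sum>j\<in>J. X j x) - real (card J) * \<mu>) \<ge> 2 * s\<^sup>2 * real (card J) * m}
    \<le> exp (- (s\<^sup>2 * real (card J) * m))" (is "prob {x \<in> space M. ?Y x \<ge> ?a} \<le> _")
proof -
  have rv[measurable]: "random_variable borel (X j)" if "j \<in> J" for j
    using indep that by (auto simp: indep_vars_def)
  have expY: "exp (?Y x) = exp (- s * real (card J) * \<mu>) * (\<Prod>j\<in>J. exp (s * X j x))" for x
    using fin by (simp add: exp_sum[symmetric] exp_add[symmetric] sum_distrib_left algebra_simps)
  have indep': "indep_vars (\<lambda>_. borel) (\<lambda>j x. exp (s * X j x)) J"
    by (rule indep_vars_compose2[OF indep, where Y = "\<lambda>_ y. exp (s * y)"]) auto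
  note mom = exp_moment_le[OF rv bd, of _ m s]
  have int: "integrable M (\<lambda>x. \<Prod>j\<in>J. exp (s * X j x))"
    using mom mean m s by (intro indep_vars_integrable fin indep') auto
  have "expectation (\<lambda>x. exp (?Y x)) =
      exp (- s * real (card J) * \<mu>) * (\<Prod>j\<in>J. expectation (\<lambda>x. exp (s * X j x)))"
    using mom mean m s fin indep' by (simp only: expY integral_mult_right_zero) (subst indep_vars_lebesgue_integral, auto)
  also have "\<dots> \<le> exp (- s * real (card J) * \<mu>) * (\<Prod>j\<in>J. exp (s * \<mu> + s\<^sup>2 * m))"
    using mom(2) mean m s by (intro mult_left_mono prod_mono) (auto intro!: integral_nonneg_AE)
  also have "\<dots> = exp (s\<^sup>2 * real (card J) * m)"
    by (simp add: exp_of_nat_mult[symmetric] exp_add[symmetric] algebra_simps)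
  finally have E: "expectation (\<lambda>x. exp (?Y x)) \<le> exp (s\<^sup>2 * real (card J) * m)" .
  have "{x \<in> space M. ?Y x \<ge> ?a} = {x \<in> space M. exp (?Y x) \<ge> exp ?a}"
    by simp
  also have "prob \<dots> \<le> expectation (\<lambda>x. exp (?Y x)) / exp ?a"
    using int by (intro integral_Markov_inequality_measure[where A = "{}"]) (auto simp: expY intro!: AE_I2 mult_nonneg_nonneg prod_nonneg)
  also have "\<dots> \<le> exp (s\<^sup>2 * real (card J) * m) / exp ?a"
    using E by (intro divide_right_mono) auto
  also have "\<dots> = exp (- (s\<^sup>2 * real (card J) * m))"
    by (simp add: exp_diff[symmetric])
  finally show ?thesis .
qed

lemma (in prob_space) chernoff_two_sided:
  fixes X :: "'i \<Rightarrow> 'a \<Rightarrow> real"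
  assumes fin: "finite J" and indep: "indep_vars (\<lambda>_. borel) X J"
    and bd: "\<And>j. j \<in> J \<Longrightarrow> AE x in M. 0 \<le> X j x \<and> X j x \<le> 1"
    and mean: "\<And>j. j \<in> J \<Longrightarrow> expectation (X j) = \<mu>"
    and m: "\<mu> \<le> m" and s: "0 < s" "s \<le> 1"
  shows "prob {x \<in> space M. \<bar>(\<Sum>j\<in>J. X j x) - real (card J) * \<mu>\<bar> > 2 * s * real (card J) * m}
    \<le> 2 * exp (- (s\<^sup>2 * real (card J) * m))"
proof -
  have rv[measurable]: "random_variable borel (X j)" if "j \<in> J" for j
    using indep that by (auto simp: indep_vars_def)
  let ?A = "\<lambda>s. {x \<in> space M. s * ((\<Sum>j\<in>J. X j x) - real (card J) * \<mu>) \<ge> 2 * s\<^sup>2 * real (card J) * m}"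
  let ?B = "{x \<in> space M. \<bar>(\<Sum>j\<in>J. X j x) - real (card J) * \<mu>\<bar> > 2 * s * real (card J) * m}"
  have sub: "?B \<subseteq> ?A s \<union> ?A (-s)"
  proof
    fix x assume x: "x \<in> ?B"
    let ?y = "(\<Sum>j\<in>J. X j x) - real (card J) * \<mu>"
    have "s * (2 * s * real (card J) * m) \<le> s * \<bar>?y\<bar>"
      using x s by (intro mult_left_mono) auto
    then have "2 * s\<^sup>2 * real (card J) * m \<le> s * \<bar>?y\<bar>"
      by (simp add: power2_eq_square mult_ac)
    then show "x \<in> ?A s \<union> ?A (-s)"
      using x by (cases "?y \<ge> 0") (auto simp: algebra_simps)
  qed
  have "prob ?B \<le> prob (?A s \<union> ?A (-s))"
    by (rule finite_measure_mono[OF sub]) measurable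
  also have "\<dots> \<le> prob (?A s) + prob (?A (-s))"
    by (rule measure_Un_le) measurable
  also have "\<dots> \<le> exp (- (s\<^sup>2 * real (card J) * m)) + exp (- ((-s)\<^sup>2 * real (card J) * m))"
    using s by (intro add_mono chernoff_signed fin indep bd mean m) auto
  finally show ?thesis by simp
qed

lemma indep_vars_PiM_subset:
  assumes P: "\<And>i. i \<in> I \<Longrightarrow> prob_space (M i)" and J: "J \<subseteq> I" "J \<noteq> {}"
  shows "prob_space.indep_vars (PiM I M) M (\<lambda>i x. x i) J"
proof -
  interpret prob_space "PiM I M" by (rule prob_space_PiM) (rule P)
  have rv: "random_variable (M i) (\<lambda>x. x i)" if "i \<in> J" for i
    using that J by (intro measurable_component_singleton) auto
  \<comment> \<open>Projection to the coordinates in \<open>J\<close> is a reindexing along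
    \<open>id\<close>, so their joint law is again a product measure.\<close>
  have "distr (PiM I M) (PiM J M) (\<lambda>x. \<lambda>i\<in>J. x i) = PiM J M"
    using distr_PiM_reindex[of I M id J] P J by (simp add: subset_eq Pi_iff)
  also have "\<dots> = PiM J (\<lambda>i. distr (PiM I M) (M i) (\<lambda>x. x i))"
    using J P by (intro PiM_cong refl distr_PiM_component[symmetric]) auto
  finally show ?thesis
    by (subst indep_vars_iff_distr_eq_PiM'[OF J(2) rv])
qed

text \<open>One function \<open>f\<close> for all coordinates covers both uses: the identity for
  rewards, the indicator of an arm for uniform draws.\<close>

lemma chernoff_PiM:
  fixes f :: "'a \<Rightarrow> real"
  assumes P: "\<And>i. i \<in> I \<Longrightarrow> prob_space (M i)" and J: "J \<subseteq> I" "finite J"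
    and meas: "\<And>j. j \<in> J \<Longrightarrow> f \<in> borel_measurable (M j)"
    and bd: "\<And>j. j \<in> J \<Longrightarrow> AE x in M j. 0 \<le> f x \<and> f x \<le> 1"
    and mean: "\<And>j. j \<in> J \<Longrightarrow> (\<integral>x. f x \<partial>M j) = \<mu>"
    and m: "\<mu> \<le> m" "0 \<le> m" and s: "0 < s" "s \<le> 1"
  shows "measure (PiM I M) {x \<in> space (PiM I M). \<bar>(\<Sum>j\<in>J. f (x j)) - real (card J) * \<mu>\<bar> > 2 * s * real (card J) * m}
    \<le> 2 * exp (- (s\<^sup>2 * real (card J) * m))"
proof (cases "J = {}")
  case False
  interpret prob_space "PiM I M" by (rule prob_space_PiM) (rule P)
  have comp: "(\<integral>x. f (x j) \<partial>PiM I M) = (\<integral>x. f x \<partial>M j)" if "j \<in> J" for j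
  proof -
    have "(\<integral>x. f x \<partial>M j) = (\<integral>x. f x \<partial>distr (PiM I M) (M j) (\<lambda>x. x j))"
      using that J P by (subst distr_PiM_component) auto
    also have "\<dots> = (\<integral>x. f (x j) \<partial>PiM I M)"
      using that J meas by (intro integral_distr measurable_component_singleton) auto
    finally show ?thesis by simp
  qed
  show ?thesis
  proof (rule chernoff_two_sided[where X = "\<lambda>j x. f (x j)"])
    show "indep_vars (\<lambda>_. borel) (\<lambda>j x. f (x j)) J"
      using indep_vars_PiM_subset[OF P J(1) False]
      by (rule indep_vars_compose2[where Y = "\<lambda>_. f"]) (use meas in auto)
    show "AE x in PiM I M. 0 \<le> f (x j) \<and> f (x j) \<le> 1" if "j \<in> J" for j
      using J that P bd by (intro AE_PiM_component) auto
  qed (use assms comp in auto)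
qed simp

subsection \<open>Runs of the algorithm\<close>

definition arm_sum :: "(nat \<times> nat \<Rightarrow> real) \<Rightarrow> nat \<Rightarrow> nat \<Rightarrow> real" where
  "arm_sum x i n = (\<Sum>j<n. x (i, j))"

text \<open>Counts the uniform draws themselves, including those of phase-2 rounds, which the
  algorithm ignores. It is therefore a function of \<open>u\<close> alone.\<close>

definition draws :: "(nat \<Rightarrow> nat) \<Rightarrow> nat \<Rightarrow> nat \<Rightarrow> nat" where
  "draws u i r = card {s \<in> {1..r}. u s = i}"

lemma draws_0 [simp]: "draws u i 0 = 0"
  by (simp add: draws_def)

lemma draws_Suc: "draws u i (Suc r) = draws u i r + (if u (Suc r) = i then 1 else 0)"
proof -
  have "{s \<in> {1..Suc r}. u s = i} = {s \<in> {1..r}. u s = i} \<union> (if u (Suc r) = i then {Suc r} else {})"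
    by (auto simp: le_Suc_eq)
  then show ?thesis by (auto simp: draws_def)
qed

lemma draws_mono: "r \<le> r' \<Longrightarrow> draws u i r \<le> draws u i r'"
  unfolding draws_def by (intro card_mono) auto

lemma draws_le: "draws u i r \<le> r"
  by (induction r) (auto simp: draws_Suc)

lemma cnt_mult_muhat: "real (cnt h i) * muhat h i = rsum h i"
  by (auto simp: muhat_def cnt_def rsum_def)

lemma cnt_snoc: "cnt (h @ [(a, r)]) i = cnt h i + (if a = i then 1 else 0)"
  by (simp add: cnt_def)

lemma rsum_snoc: "rsum (h @ [(a, r)]) i = rsum h i + (if a = i then r else 0)"
  by (simp add: rsum_def)

text \<open>Cauchy-Schwarz against the constant vector 1.\<close>

lemma sum_sqrt_le:
  assumes "finite A" "\<And>i. i \<in> A \<Longrightarrow> 0 \<le> c i"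
  shows "(\<Sum>i\<in>A. sqrt (c i)) \<le> sqrt (real (card A) * (\<Sum>i\<in>A. c i))"
proof -
  have "(\<Sum>i\<in>A. 1 * sqrt (c i)) \<le> L2_set (\<lambda>_. 1) A * L2_set (\<lambda>i. sqrt (c i)) A"
    using L2_set_mult_ineq[of "\<lambda>_. 1" "\<lambda>i. sqrt (c i)" A] assms by simp
  also have "\<dots> = sqrt (real (card A) * (\<Sum>i\<in>A. c i))"
    using assms by (simp add: L2_set_def real_sqrt_mult)
  finally show ?thesis by simp
qed

text \<open>Bounds 1 / sqrt n by a telescoping increment. The difference of the roots is the inverse
  of their sum, and sqrt (n + 1) \<le> 2 sqrt n gives the crude factor 4.\<close>

lemma inverse_sqrt_le_diff:
  fixes n :: real
  assumes "n \<ge> 1"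
  shows "1 / sqrt n \<le> 4 * (sqrt (n + 1) - sqrt n)"
proof -
  have "sqrt (n + 1) \<le> sqrt (4 * n)" using assms by simp
  then have "sqrt (n + 1) + sqrt n \<le> 4 * sqrt n"
    using assms real_sqrt_ge_zero[of n] by (simp only: real_sqrt_mult real_sqrt_four) linarith
  moreover have "(sqrt (n + 1) - sqrt n) * (sqrt (n + 1) + sqrt n) = 1"
    using assms by (simp add: algebra_simps)
  moreover have "sqrt (n + 1) - sqrt n \<ge> 0" by simp
  ultimately have "1 \<le> (sqrt (n + 1) - sqrt n) * (4 * sqrt n)"
    by (metis mult_left_mono)
  then show ?thesis using assms by (simp add: field_simps)
qed

section \<open>Pathwise facts about a run with fixed reward table and draws\<close>

locale ncb_run =
  fixes k T :: nat and v :: "hist \<Rightarrow> nat \<Rightarrow> real" and sel :: "hist \<Rightarrow> nat"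
    and x :: "nat \<times> nat \<Rightarrow> real" and u :: "nat \<Rightarrow> nat"
  assumes k: "k \<ge> 1" and sel: "ncb_selector k T v sel"
    and u_less: "\<And>t. t \<in> {1..T} \<Longrightarrow> u t < k"
begin

abbreviation "H t \<equiv> fst (alg_state k T v sel x u t)"
abbreviation "phase2 t \<equiv> snd (alg_state k T v sel x u t)"
abbreviation "arm t \<equiv> arm_at k T v sel t (x, u)"

text \<open>3780 is 420 c^2 with c = 3, and pull count times empirical mean is the reward
  sum.\<close>

lemma phase2_Suc: "phase2 (Suc t) \<longleftrightarrow> phase2 t \<or> (\<exists>i<k. rsum (H t) i > 3780 * ln (real T))"
proof -
  have ne: "{..<k} \<noteq> {}" using k by (auto simp: lessThan_empty_iff)
  have "Max (rsum (H t) ` {..<k}) \<le> 3780 * ln (real T) \<longleftrightarrow> (\<forall>i<k. rsum (H t) i \<le> 3780 * ln (real T))"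
    using ne by (subst Max_le_iff) auto
  then show ?thesis
    by (auto simp: Let_def case_prod_beta cnt_mult_muhat ncb_c_def not_le)
qed

lemma arm_Suc: "arm (Suc t) = (if phase2 (Suc t) then sel (H t) else u (Suc t))"
  by (auto simp: arm_at_def Let_def case_prod_beta)

lemma H_Suc: "H (Suc t) = H t @ [(arm (Suc t), x (arm (Suc t), cnt (H t) (arm (Suc t))))]"
  by (auto simp: arm_at_def Let_def case_prod_beta)

declare alg_state.simps(2) [simp del]

lemma cnt_H_Suc: "cnt (H (Suc t)) i = cnt (H t) i + (if arm (Suc t) = i then 1 else 0)"
  by (simp add: H_Suc cnt_snoc)

text \<open>The j-th pull of an arm reads table entry j, so the history enters only through the pull
  count. Concentration for every fixed \<open>n\<close> then applies at the random, adaptively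
  chosen counts.\<close>

lemma rsum_H: "rsum (H t) i = arm_sum x i (cnt (H t) i)"
  by (induction t) (auto simp: H_Suc cnt_snoc rsum_snoc arm_sum_def, simp_all add: rsum_def cnt_def)

lemma cnt_H_0 [simp]: "cnt (H 0) i = 0"
  by (simp add: cnt_def)

lemma cnt_H_le: "cnt (H t) i \<le> t"
  by (induction t) (auto simp: cnt_H_Suc simp del: alg_state.simps)

lemma cnt_H_mono: "t \<le> t' \<Longrightarrow> cnt (H t) i \<le> cnt (H t') i"
  by (rule lift_Suc_mono_le[of "\<lambda>t. cnt (H t) i"]) (auto simp: cnt_H_Suc)

lemma phase2_mono: "t \<le> t' \<Longrightarrow> phase2 t \<Longrightarrow> phase2 t'"
  by (induction t' rule: dec_induct) (auto simp: phase2_Suc)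

lemma cnt_H_phase1: "\<not> phase2 t \<Longrightarrow> cnt (H t) i = draws u i t"
proof (induction t)
  case (Suc t)
  then have "\<not> phase2 t" by (auto simp: phase2_Suc)
  with Suc show ?case by (simp add: cnt_H_Suc draws_Suc arm_Suc)
qed (simp del: alg_state.simps)

lemma arm_less: "t \<in> {1..T} \<Longrightarrow> arm t < k"
  using sel u_less[of t] by (cases t) (auto simp: arm_Suc ncb_selector_def)

lemma sum_cnt_H: "t \<le> T \<Longrightarrow> (\<Sum>i<k. cnt (H t) i) = t"
proof (induction t)
  case (Suc t)
  have "arm (Suc t) < k" using Suc by (intro arm_less) auto
  then show ?case using Suc by (simp add: cnt_H_Suc sum.distrib)
qed (simp del: alg_state.simps)

lemma ncb_le_arm: "phase2 (Suc t) \<Longrightarrow> j < k \<Longrightarrow> ncb T v (H t) j \<le> ncb T v (H t) (arm (Suc t))"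
  using sel by (auto simp: arm_Suc ncb_selector_def)

text \<open>The sum of the roots of the counts is a potential: a pull changes a single summand, and
  by \<open>inverse_sqrt_le_diff\<close> four times the increase pays for that round's term.\<close>

lemma sum_inverse_sqrt_le_potential:
  assumes "t \<le> T" "R \<le> t" and pos: "\<And>s. R \<le> s \<Longrightarrow> s < t \<Longrightarrow> cnt (H s) (arm (Suc s)) \<ge> 1"
  shows "(\<Sum>s=R..<t. 1 / sqrt (real (cnt (H s) (arm (Suc s))))) \<le> 4 * (\<Sum>i<k. sqrt (real (cnt (H t) i)))"
  using assms(2,1) pos
proof (induction t rule: dec_induct)
  case (step t)
  let ?a = "arm (Suc t)"
  have a: "?a < k" using step by (intro arm_less) auto
  have "1 / sqrt (real (cnt (H t) ?a)) \<le> 4 * (sqrt (real (cnt (H t) ?a) + 1) - sqrt (real (cnt (H t) ?a)))"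
    using step by (intro inverse_sqrt_le_diff) (auto simp: Suc_le_eq)
  also have "\<dots> = 4 * (\<Sum>i<k. sqrt (real (cnt (H (Suc t)) i)) - sqrt (real (cnt (H t) i)))"
  proof -
    have "(\<Sum>i<k. sqrt (real (cnt (H (Suc t)) i)) - sqrt (real (cnt (H t) i)))
      = (\<Sum>i<k. if i = ?a then sqrt (real (cnt (H t) ?a) + 1) - sqrt (real (cnt (H t) ?a)) else 0)"
      by (intro sum.cong) (auto simp: cnt_H_Suc add.commute)
    then show ?thesis using a by simp
  qed
  finally show ?case using step by (simp add: sum_subtractf)
qed (simp add: sum_nonneg)

text \<open>The counts of the \<open>k\<close> arms add up to \<open>T\<close>, so by Cauchy-Schwarz
  the potential is largest, sqrt (k T), when they are equal.\<close>

lemma sum_inverse_sqrt_le: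
  assumes "R \<le> T" and pos: "\<And>s. R \<le> s \<Longrightarrow> s < T \<Longrightarrow> cnt (H s) (arm (Suc s)) \<ge> 1"
  shows "(\<Sum>s=R..<T. 1 / sqrt (real (cnt (H s) (arm (Suc s))))) \<le> 4 * sqrt (real k * real T)"
proof -
  have "(\<Sum>i<k. sqrt (real (cnt (H T) i))) \<le> sqrt (real (card {..<k}) * (\<Sum>i<k. real (cnt (H T) i)))"
    by (rule sum_sqrt_le) auto
  also have "(\<Sum>i<k. real (cnt (H T) i)) = real T"
    using sum_cnt_H[of T] by (metis of_nat_sum order_refl)
  finally show ?thesis using sum_inverse_sqrt_le_potential[of T R] assms by simp
qed

end

text \<open>The deviation width in \<open>conc\<close> uses the best mean \<open>M\<close> rather than the mean of the
  arm at hand, so that one estimate covers good and bad arms alike.\<close>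

locale good_run = ncb_run +
  fixes \<mu> :: "nat \<Rightarrow> real" and M :: real and b R R' :: nat
  assumes T: "ln (real T) \<ge> 1"
    and b: "b < k" "\<mu> b = M" and M: "0 < M" "M \<le> 1" and \<mu>_le: "\<And>i. i < k \<Longrightarrow> \<mu> i \<le> M"
    and x01: "\<And>i j. i < k \<Longrightarrow> j < T \<Longrightarrow> 0 \<le> x (i, j) \<and> x (i, j) \<le> 1"
    and unif: "\<And>i r. i < k \<Longrightarrow> r \<le> T \<Longrightarrow> 1600 * real k * ln (real T) \<le> real r \<Longrightarrow>
         \<bar>real (draws u i r) - real r / real k\<bar> \<le> real r / (2 * real k)"
    and conc: "\<And>i n. i < k \<Longrightarrow> n \<le> T \<Longrightarrow> 800 * ln (real T) \<le> real n * M \<Longrightarrow>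
         \<bar>arm_sum x i n - real n * \<mu> i\<bar> \<le> 2 * sqrt (2 * ln (real T) * (real n * M))"
    and R: "R = nat \<lceil>1600 * real k * ln (real T) / M\<rceil>"
    and R': "R' = nat \<lceil>10000 * real k * ln (real T) / M\<rceil>" "R' \<le> T"
begin

section \<open>Length of phase 1 and gaps in phase 2 on a good run\<close>

abbreviation "L \<equiv> ln (real T)"

text \<open>The threshold 800 L gives 2 L q \<le> q^2 / 400. With q = n M, deviations allowed by
  \<open>conc\<close> are then at most a tenth of n M.\<close>

lemma width_le:
  assumes "800 * L \<le> q"
  shows "sqrt (2 * L * q) \<le> q / 20"
proof (rule real_le_lsqrt)
  have "800 * L * q \<le> q * q" using assms T by (intro mult_right_mono) auto
  then show "2 * L * q \<le> (q / 20)\<^sup>2" by (simp add: power2_eq_square)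
qed (use assms T in auto)

lemma R_bounds: "1600 * real k * L / M \<le> real R" "real R \<le> 1600 * real k * L / M + 1"
  "1600 * real k * L \<le> real R"
proof -
  have nn: "0 \<le> 1600 * real k * L / M" using T M by simp
  show 1: "1600 * real k * L / M \<le> real R" unfolding R by (rule real_nat_ceiling_ge)
  show "real R \<le> 1600 * real k * L / M + 1" unfolding R using nn by linarith
  have "1600 * real k * L \<le> 1600 * real k * L / M"
    using T M by (simp add: le_divide_eq mult_left_le)
  with 1 show "1600 * real k * L \<le> real R" by linarith
qed

lemma R'_bounds: "10000 * real k * L / M \<le> real R'" "R \<le> R'"
proof -
  show "10000 * real k * L / M \<le> real R'" unfolding R' by (rule real_nat_ceiling_ge)
  show "R \<le> R'" unfolding R R' using T M
    by (intro nat_mono ceiling_mono divide_right_mono mult_right_mono) auto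
qed

lemma arm_sum_mono: "i < k \<Longrightarrow> n \<le> n' \<Longrightarrow> n' \<le> T \<Longrightarrow> arm_sum x i n \<le> arm_sum x i n'"
  unfolding arm_sum_def using x01 by (intro sum_mono2) auto

text \<open>Balanced draws give each arm between 1/2 and 3/2 of R / k draws. The lower bound
  suffices for \<open>conc\<close>; the upper one is too small for any reward sum to reach 3780
  L.\<close>

lemma draws_R:
  assumes i: "i < k"
  shows "800 * L \<le> real (draws u i R) * M" "real (draws u i R) * M \<le> 2400 * L + 2"
proof -
  have "R \<le> T" using R'_bounds(2) R'(2) by (rule order_trans)
  then have *: "\<bar>real (draws u i R) - real R / real k\<bar> \<le> real R / (2 * real k)"
    using R_bounds(3) by (intro unif i)
  have kp: "real k > 0" using k by simp
  have half: "r / real k = 2 * (r / (2 * real k))" for r by simp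
  have lo: "real R / (2 * real k) \<le> real (draws u i R)" and hi: "real (draws u i R) \<le> 3 * (real R / (2 * real k))"
    using * half[of "real R"] by (simp_all only: abs_le_iff) linarith+
  have "800 * L / M = (1600 * real k * L / M) / (2 * real k)" using kp by simp
  also have "\<dots> \<le> real R / (2 * real k)" using R_bounds(1) kp by (intro divide_right_mono) auto
  also note lo
  finally show "800 * L \<le> real (draws u i R) * M" using M by (simp add: field_simps)
  note hi
  also have "3 * (real R / (2 * real k)) \<le> 3 * ((1600 * real k * L / M + 1) / (2 * real k))"
    using R_bounds(2) kp by (intro mult_left_mono divide_right_mono) auto
  also have "\<dots> = 2400 * L / M + 3 / (2 * real k)" using kp by (simp add: field_simps)
  also have "\<dots> \<le> 2400 * L / M + 2" using k by (simp add: field_simps)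
  finally have "real (draws u i R) * M \<le> (2400 * L / M + 2) * M"
    using M by (intro mult_right_mono) auto
  also have "\<dots> = 2400 * L + 2 * M" using M by (simp add: field_simps)
  finally show "real (draws u i R) * M \<le> 2400 * L + 2" using M by simp
qed

text \<open>Rewards are nonnegative, so as long as phase 1 lasts an arm's reward sum is at most the
  sum of its first \<open>draws u i R\<close> table entries.\<close>

lemma not_phase2: "t \<le> R \<Longrightarrow> \<not> phase2 t"
proof (induction t)
  case (Suc t)
  then have np: "\<not> phase2 t" by simp
  have "rsum (H t) i \<le> 3780 * L" if i: "i < k" for i
  proof -
    let ?n = "draws u i R"
    have n: "?n \<le> T" using draws_le[of u i R] R'_bounds(2) R'(2) by linarith
    have "rsum (H t) i = arm_sum x i (draws u i t)" by (simp add: rsum_H cnt_H_phase1[OF np])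
    also have "\<dots> \<le> arm_sum x i ?n" using Suc n by (intro arm_sum_mono i draws_mono) auto
    also have "\<dots> \<le> real ?n * \<mu> i + 2 * sqrt (2 * L * (real ?n * M))"
      using conc[OF i n draws_R(1)[OF i]] by linarith
    also have "\<dots> \<le> real ?n * M + 2 * ((real ?n * M) / 20)"
      using \<mu>_le[OF i] width_le[OF draws_R(1)[OF i]] by (intro add_mono mult_left_mono) auto
    \<comment> \<open>At most 1.1 (2400 L + 2) = 2640 L + 2.2, where L \<ge> 1.\<close>
    also have "\<dots> \<le> 3780 * L" using draws_R(2)[OF i] T by linarith
    finally show ?thesis .
  qed
  then show ?case using np by (metis phase2_Suc not_less)
qed simp

text \<open>Otherwise the best arm \<open>b\<close> has n draws with n M \<ge> 5000 L after
  \<open>R'\<close> rounds, hence reward sum at least 0.9 * 5000 L = 4500 L, above the stopping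
  level. The test before round \<open>Suc R'\<close> reads the history of \<open>R'\<close>
  rounds.\<close>

lemma phase2_after_R':
  assumes "t \<ge> R'"
  shows "phase2 (Suc t)"
proof -
  have "phase2 (Suc R')"
  proof (rule ccontr)
    assume np: "\<not> phase2 (Suc R')"
    then have np': "\<not> phase2 R'" and small: "rsum (H R') b \<le> 3780 * L"
      using b(1) by (metis phase2_Suc not_less)+
    let ?n = "draws u b R'"
    have n: "?n \<le> T" using draws_le[of u b R'] R'(2) by simp
    have "1600 * real k * L \<le> real R'" using R_bounds(3) R'_bounds(2) by linarith
    then have *: "\<bar>real ?n - real R' / real k\<bar> \<le> real R' / (2 * real k)"
      using b(1) R'(2) by (intro unif)
    have kp: "real k > 0" using k by simp
    have half: "real R' / real k = 2 * (real R' / (2 * real k))" by simp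
    have lo: "real R' / (2 * real k) \<le> real ?n"
      using * half by (simp only: abs_le_iff) linarith
    have "5000 * L / M = (10000 * real k * L / M) / (2 * real k)" using kp by simp
    also have "\<dots> \<le> real R' / (2 * real k)" using R'_bounds(1) kp by (intro divide_right_mono) auto
    also note lo
    finally have q: "5000 * L \<le> real ?n * M" using M by (simp add: field_simps)
    then have q': "800 * L \<le> real ?n * M" using T by linarith
    have "real ?n * M \<le> arm_sum x b ?n + 2 * sqrt (2 * L * (real ?n * M))"
      using conc[OF b(1) n q'] b(2) by (simp add: abs_le_iff)
    also have "arm_sum x b ?n = rsum (H R') b" by (simp add: rsum_H cnt_H_phase1[OF np'])
    finally show False using small width_le[OF q'] q T by linarith
  qed
  then show ?thesis using assms phase2_mono[of "Suc R'" "Suc t"] by simp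
qed

text \<open>At least \<open>R\<close> phase-1 rounds have passed, so \<open>draws_R\<close> applies
  to every arm. In particular the arbitrary index \<open>v\<close> of an unpulled arm never competes
  in phase 2.\<close>

lemma phase2_counts:
  assumes "phase2 (Suc t)" "i < k"
  shows "800 * L \<le> real (cnt (H t) i) * M" "cnt (H t) i \<ge> 1"
proof -
  have "R \<le> t" using not_phase2[of "Suc t"] assms by (meson not_less_eq_eq)
  then have "draws u i R \<le> cnt (H t) i"
    using cnt_H_mono[of R t i] cnt_H_phase1[of R i] not_phase2[of R] by simp
  then have "real (draws u i R) * M \<le> real (cnt (H t) i) * M"
    using M by (intro mult_right_mono) auto
  then show *: "800 * L \<le> real (cnt (H t) i) * M" using draws_R(1)[OF assms(2)] by linarith
  show "cnt (H t) i \<ge> 1"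
  proof (rule ccontr)
    assume "\<not> ?thesis"
    then have "cnt (H t) i = 0" by simp
    with * T show False by simp
  qed
qed

text \<open>\<open>conc\<close> and \<open>width_le\<close> divided by the pull count;
  \<open>e\<close> is sqrt (2 L n M) / n.\<close>

lemma muhat_close:
  assumes "phase2 (Suc t)" "i < k" "t \<le> T"
  defines "e \<equiv> sqrt (2 * L * M / real (cnt (H t) i))"
  shows "\<bar>muhat (H t) i - \<mu> i\<bar> \<le> 2 * e" "e \<le> M / 20"
proof -
  let ?n = "cnt (H t) i"
  note c = phase2_counts[OF assms(1,2)]
  have np: "real ?n > 0" using c by simp
  have e: "sqrt (2 * L * (real ?n * M)) = real ?n * e"
  proof -
    have "2 * L * (real ?n * M) = (real ?n)\<^sup>2 * (2 * L * M / real ?n)"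
      using np by (simp add: power2_eq_square)
    then show ?thesis using np by (simp only: e_def real_sqrt_mult real_sqrt_abs)
  qed
  have "?n \<le> T" using cnt_H_le[of t i] assms by simp
  then have "\<bar>arm_sum x i ?n - real ?n * \<mu> i\<bar> \<le> 2 * (real ?n * e)"
    using conc[OF assms(2) _ c(1)] e by simp
  moreover have "arm_sum x i ?n = real ?n * muhat (H t) i" by (simp add: cnt_mult_muhat rsum_H)
  ultimately have "real ?n * \<bar>muhat (H t) i - \<mu> i\<bar> \<le> real ?n * (2 * e)"
    using np by (simp add: right_diff_distrib[symmetric] abs_mult)
  then show "\<bar>muhat (H t) i - \<mu> i\<bar> \<le> 2 * e" using np by simp
  have "real ?n * e \<le> real ?n * M / 20" using width_le[OF c(1)] e by simp
  then show "e \<le> M / 20" using np by (simp add: field_simps)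
qed

text \<open>Optimism: the index of the best arm is at least \<open>M\<close>, and the index of the
  pulled arm exceeds its mean by at most 9 widths \<open>e\<close>. The second claim follows from 9
  e \<le> 9 M / 20.\<close>

lemma gap_phase2:
  assumes p: "phase2 (Suc t)" and t: "t < T"
  shows "M - \<mu> (arm (Suc t)) \<le> 9 * sqrt (2 * L * M / real (cnt (H t) (arm (Suc t))))"
    and "\<mu> (arm (Suc t)) \<ge> M / 2"
proof -
  define a where "a = arm (Suc t)"
  have a: "a < k" unfolding a_def using t by (intro arm_less) auto
  define e where "e i = sqrt (2 * L * M / real (cnt (H t) i))" for i
  have cl: "\<bar>muhat (H t) i - \<mu> i\<bar> \<le> 2 * e i" "e i \<le> M / 20" if "i < k" for i
    using muhat_close[OF p that] t by (auto simp: e_def)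
  have e0: "e i \<ge> 0" for i using T M by (simp add: e_def)
  have c0: "real (cnt (H t) i) > 0" if "i < k" for i using phase2_counts(2)[OF p that] by simp
  have ncb: "ncb T v (H t) i = muhat (H t) i + 6 * sqrt (2 * muhat (H t) i * L / real (cnt (H t) i))"
    if "i < k" for i
    using c0[OF that] by (auto simp: ncb_def ncb_c_def)
  \<comment> \<open>Empirical means are compared with square multiples of \<open>M\<close>, so that
    the factor leaves the root and \<open>e\<close> remains.\<close>
  have sc: "sqrt (2 * (y\<^sup>2 * M) * L / real (cnt (H t) i)) = y * e i" if "y \<ge> 0" for y i
  proof -
    have "2 * (y\<^sup>2 * M) * L / real (cnt (H t) i) = y\<^sup>2 * (2 * L * M / real (cnt (H t) i))" by simp
    then show ?thesis using that by (simp only: e_def real_sqrt_mult) simp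
  qed
  have "M \<le> ncb T v (H t) b"
  proof -
    have m: "muhat (H t) b \<ge> M - 2 * e b" using cl(1)[OF b(1)] b(2) by linarith
    \<comment> \<open>The empirical mean is at least 0.9 M \<ge> 0.81 M, so the bonus is at least 6
      * 0.9 e, more than the possible underestimate 2 e.\<close>
    then have "muhat (H t) b \<ge> (9/10)\<^sup>2 * M"
      using cl(2)[OF b(1)] M by (simp add: power2_eq_square)
    then have "sqrt (2 * ((9/10)\<^sup>2 * M) * L / real (cnt (H t) b)) \<le> sqrt (2 * muhat (H t) b * L / real (cnt (H t) b))"
      using T by (intro real_sqrt_le_mono divide_right_mono mult_right_mono mult_left_mono) auto
    then have "(9/10) * e b \<le> sqrt (2 * muhat (H t) b * L / real (cnt (H t) b))"
      by (subst (asm) sc) auto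
    then show ?thesis using m e0[of b] by (simp add: ncb[OF b(1)])
  qed
  also have "\<dots> \<le> ncb T v (H t) a" unfolding a_def by (rule ncb_le_arm[OF p b(1)])
  also have "\<dots> \<le> \<mu> a + 9 * e a"
  proof -
    have m: "muhat (H t) a \<le> \<mu> a + 2 * e a" using cl(1)[OF a] by linarith
    \<comment> \<open>The empirical mean is at most 1.1 M \<le> 1.21 M, so bonus and overestimate
      together are at most 6 * 1.1 e + 2 e = 8.6 e.\<close>
    then have "muhat (H t) a \<le> (11/10)\<^sup>2 * M"
      using cl(2)[OF a] \<mu>_le[OF a] M by (simp add: power2_eq_square)
    then have "sqrt (2 * muhat (H t) a * L / real (cnt (H t) a)) \<le> sqrt (2 * ((11/10)\<^sup>2 * M) * L / real (cnt (H t) a))"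
      using T by (intro real_sqrt_le_mono divide_right_mono mult_right_mono mult_left_mono) auto
    also have "\<dots> = (11/10) * e a" by (rule sc) simp
    finally show ?thesis using m e0[of a] by (simp add: ncb[OF a])
  qed
  finally have fin: "M \<le> \<mu> a + 9 * e a" .
  then show "M - \<mu> (arm (Suc t)) \<le> 9 * sqrt (2 * L * M / real (cnt (H t) (arm (Suc t))))"
    by (simp add: a_def e_def)
  show "\<mu> (arm (Suc t)) \<ge> M / 2"
    using fin cl(2)[OF a] M unfolding a_def by linarith
qed

lemma mean_ge_if_draw_best:
  assumes "t \<in> {1..T}" "u t = b"
  shows "\<mu> (arm t) \<ge> M / 2"
proof (cases t)
  case (Suc s)
  show ?thesis
  proof (cases "phase2 t")
    case True
    then show ?thesis using gap_phase2(2)[of s] Suc assms by simp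
  next
    case False
    then have "arm t = b" using assms by (simp add: Suc arm_Suc)
    then show ?thesis using b M by simp
  qed
qed (use assms in auto)

lemma mean_ge_after_R':
  assumes "t \<in> {R'<..T}"
  shows "\<mu> (arm t) \<ge> M / 2"
proof (cases t)
  case (Suc s)
  then show ?thesis using gap_phase2(2)[of s] phase2_after_R'[of s] assms by simp
qed (use assms in auto)

text \<open>Each gap is 9 sqrt (2 L M) times an inverse root of a pull count, summed by
  \<open>sum_inverse_sqrt_le\<close>; 36 sqrt 2 \<le> 54 is rounded up to 60.\<close>

lemma sum_gap_le: "(\<Sum>t\<in>{R'<..T}. M - \<mu> (arm t)) \<le> 60 * sqrt (L * M * (real k * real T))"
proof -
  have "(\<Sum>t\<in>{R'<..T}. M - \<mu> (arm t)) = (\<Sum>s=R'..<T. M - \<mu> (arm (Suc s)))"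
    by (rule sum.reindex_bij_witness[of _ Suc "\<lambda>t. t - 1"]) auto
  also have "\<dots> \<le> (\<Sum>s=R'..<T. 9 * sqrt (2 * L * M / real (cnt (H s) (arm (Suc s)))))"
    using phase2_after_R' by (intro sum_mono gap_phase2(1)) auto
  also have "\<dots> = 9 * sqrt (2 * L * M) * (\<Sum>s=R'..<T. 1 / sqrt (real (cnt (H s) (arm (Suc s)))))"
    by (simp add: sum_distrib_left real_sqrt_divide real_sqrt_mult)
  also have "\<dots> \<le> 9 * sqrt (2 * L * M) * (4 * sqrt (real k * real T))"
  proof (intro mult_left_mono sum_inverse_sqrt_le R')
    fix s assume "R' \<le> s" "s < T"
    then show "cnt (H s) (arm (Suc s)) \<ge> 1"
      by (intro phase2_counts(2) phase2_after_R' arm_less) auto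
  qed (use T M in auto)
  also have "\<dots> = 36 * sqrt 2 * sqrt (L * M * (real k * real T))"
    by (simp add: real_sqrt_mult)
  also have "\<dots> \<le> 60 * sqrt (L * M * (real k * real T))"
  proof (intro mult_right_mono)
    have "sqrt 2 \<le> 3/2" by (rule real_le_lsqrt) (auto simp: power2_eq_square)
    then show "36 * sqrt 2 \<le> 60" by simp
  qed (use T M in auto)
  finally show ?thesis .
qed

end

subsection \<open>Probability of the good event\<close>

lemma distr_pair_snd:
  assumes "prob_space A" "prob_space B"
  shows "distr (A \<Otimes>\<^sub>M B) B snd = B"
proof (rule measure_eqI)
  interpret A: prob_space A by fact
  interpret B: prob_space B by fact
  fix X assume "X \<in> sets (distr (A \<Otimes>\<^sub>M B) B snd)"
  then have X: "X \<in> sets B" by simp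
  have "snd -` X \<inter> space (A \<Otimes>\<^sub>M B) = space A \<times> X"
    using sets.sets_into_space[OF X] by (auto simp: space_pair_measure)
  then show "emeasure (distr (A \<Otimes>\<^sub>M B) B snd) X = emeasure B X"
    using X by (simp add: emeasure_distr B.emeasure_pair_measure_Times A.emeasure_space_1)
qed simp

lemma sum_indicator_eq_draws: "(\<Sum>s=1..r. indicator {i} (u s)) = real (draws u i r)"
  by (induction r) (auto simp: draws_Suc)

context
  fixes k T :: nat and D :: "nat \<Rightarrow> real measure"
  assumes k: "k \<ge> 1" and valid: "valid_instance k D"
begin

abbreviation rewards :: "(nat \<times> nat \<Rightarrow> real) measure" where
  "rewards \<equiv> PiM ({..<k} \<times> {..<T}) (\<lambda>ij. D (fst ij))"

abbreviation explore :: "(nat \<Rightarrow> nat) measure" where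
  "explore \<equiv> PiM {1..T} (\<lambda>_. measure_pmf (pmf_of_set {..<k}))"

lemma prob_space_arm: "i < k \<Longrightarrow> prob_space (D i)"
  using valid by (simp add: valid_instance_def)

lemma sets_arm: "i < k \<Longrightarrow> sets (D i) = sets borel"
  using valid by (simp add: valid_instance_def)

lemma AE_arm: assumes "i < k" shows "AE y in D i. 0 \<le> y \<and> y \<le> 1"
proof -
  interpret prob_space "D i" by (rule prob_space_arm[OF assms])
  have "prob {0..1} = 1" using valid assms by (simp add: valid_instance_def)
  then have "AE y in D i. y \<in> {0..1}"
    using sets_arm[OF assms] by (intro AE_prob_1)
  then show ?thesis by eventually_elim auto
qed

lemma id_measurable_arm: "i < k \<Longrightarrow> (\<lambda>y. y) \<in> borel_measurable (D i)"
  using sets_arm by (intro measurable_ident_sets)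

lemma arm_mean_nonneg: "i < k \<Longrightarrow> 0 \<le> arm_mean D i"
  unfolding arm_mean_def by (rule integral_nonneg_AE) (use AE_arm in \<open>auto elim: eventually_mono\<close>)

lemma arm_mean_le_1: assumes "i < k" shows "arm_mean D i \<le> 1"
proof -
  interpret prob_space "D i" by (rule prob_space_arm[OF assms])
  have "integrable (D i) (\<lambda>y. y)"
    using AE_arm[OF assms] id_measurable_arm[OF assms]
    by (intro integrable_const_bound[where B = 1]) (auto elim: eventually_mono)
  then show ?thesis
    unfolding arm_mean_def using AE_arm[OF assms]
    by (intro integral_le_const) (auto elim: eventually_mono)
qed

lemma prob_space_rewards: "prob_space rewards"
  by (rule prob_space_PiM) (auto intro: prob_space_arm)

lemma prob_space_explore: "prob_space explore"
  by (rule prob_space_PiM) (rule prob_space_measure_pmf)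

lemma prob_space_bandit: "prob_space (bandit_space k T D)"
proof -
  interpret A: prob_space rewards by (rule prob_space_rewards)
  interpret B: prob_space explore by (rule prob_space_explore)
  interpret pair_prob_space rewards explore ..
  show ?thesis unfolding bandit_space_def by (rule prob_space_axioms)
qed

lemma distr_bandit_fst: "distr (bandit_space k T D) rewards fst = rewards"
  unfolding bandit_space_def by (rule prob_space.distr_pair_fst[OF prob_space_explore])

lemma distr_bandit_snd: "distr (bandit_space k T D) explore snd = explore"
  unfolding bandit_space_def by (rule distr_pair_snd[OF prob_space_rewards prob_space_explore])

lemma measurable_bandit_fst: "fst \<in> measurable (bandit_space k T D) rewards"
  and measurable_bandit_snd: "snd \<in> measurable (bandit_space k T D) explore"
  by (auto simp: bandit_space_def)

text \<open>Only almost sure: an arm's measure lives on all of \<open>borel\<close>, and the space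
  of a pmf contains every natural number.\<close>

lemma AE_bandit: "AE \<omega> in bandit_space k T D.
  (\<forall>p\<in>{..<k} \<times> {..<T}. 0 \<le> fst \<omega> p \<and> fst \<omega> p \<le> 1) \<and> (\<forall>t\<in>{1..T}. snd \<omega> t < k)"
proof (rule AE_conjI)
  have "AE x in rewards. \<forall>p\<in>{..<k} \<times> {..<T}. 0 \<le> x p \<and> x p \<le> 1"
  proof (intro AE_finite_allI)
    fix p assume p: "p \<in> {..<k} \<times> {..<T}"
    show "AE x in rewards. 0 \<le> x p \<and> x p \<le> 1"
      using p prob_space_arm AE_arm[of "fst p"] by (intro AE_PiM_component) auto
  qed auto
  then show "AE \<omega> in bandit_space k T D. \<forall>p\<in>{..<k} \<times> {..<T}. 0 \<le> fst \<omega> p \<and> fst \<omega> p \<le> 1"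
    by (intro AE_distrD[OF measurable_bandit_fst]) (simp only: distr_bandit_fst)
  have "AE u in explore. \<forall>t\<in>{1..T}. u t < k"
  proof (intro AE_finite_allI)
    fix t assume t: "t \<in> {1..T}"
    have "AE a in measure_pmf (pmf_of_set {..<k}). a < k"
      using k by (auto simp: AE_measure_pmf_iff set_pmf_of_set lessThan_empty_iff)
    then show "AE u in explore. u t < k"
      using t by (intro AE_PiM_component prob_space_measure_pmf)
  qed auto
  then show "AE \<omega> in bandit_space k T D. \<forall>t\<in>{1..T}. snd \<omega> t < k"
    by (intro AE_distrD[OF measurable_bandit_snd]) (simp only: distr_bandit_snd)
qed

lemma prob_draw:
  assumes t: "t \<in> {1..T}" and b: "b < k"
  shows "{\<omega> \<in> space (bandit_space k T D). snd \<omega> t = b} \<in> sets (bandit_space k T D)"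
    "measure (bandit_space k T D) {\<omega> \<in> space (bandit_space k T D). snd \<omega> t = b} = 1 / real k"
proof -
  let ?B = "bandit_space k T D" and ?U = "measure_pmf (pmf_of_set {..<k})"
  have m: "(\<lambda>u. u t) \<in> measurable explore ?U"
    using t by (rule measurable_component_singleton)
  have m': "(\<lambda>\<omega>. snd \<omega> t) \<in> measurable ?B ?U"
    using measurable_compose[OF measurable_bandit_snd m] .
  have eq: "{\<omega> \<in> space ?B. snd \<omega> t = b} = (\<lambda>\<omega>. snd \<omega> t) -` {b} \<inter> space ?B" by auto
  show "{\<omega> \<in> space ?B. snd \<omega> t = b} \<in> sets ?B"
    unfolding eq using m' by (rule measurable_sets) simp
  have "distr ?B ?U (\<lambda>\<omega>. snd \<omega> t) = distr (distr ?B explore snd) ?U (\<lambda>u. u t)"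
    using distr_distr[OF m measurable_bandit_snd] by (simp add: comp_def)
  also have "\<dots> = ?U"
    unfolding distr_bandit_snd using t by (intro distr_PiM_component prob_space_measure_pmf)
  finally have d: "distr ?B ?U (\<lambda>\<omega>. snd \<omega> t) = ?U" .
  have "measure ?B ((\<lambda>\<omega>. snd \<omega> t) -` {b} \<inter> space ?B) = measure ?U {b}"
    by (subst d[symmetric], subst measure_distr[OF m']) auto
  also have "\<dots> = 1 / real k"
    using k b by (simp add: measure_pmf_single pmf_of_set lessThan_empty_iff)
  finally show "measure ?B {\<omega> \<in> space ?B. snd \<omega> t = b} = 1 / real k"
    by (simp add: eq)
qed

lemma prob_rewards_deviation:
  assumes i: "i < k" and n: "n \<le> T" and T: "ln (real T) \<ge> 1" and nM: "800 * ln (real T) \<le> real n * m"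
    and m: "arm_mean D i \<le> m"
  shows "measure rewards {x \<in> space rewards. \<bar>arm_sum x i n - real n * arm_mean D i\<bar> > 2 * sqrt (2 * ln (real T) * (real n * m))}
    \<le> 2 / (real T)\<^sup>2"
proof -
  let ?L = "ln (real T)"
  have m0: "0 \<le> m" using arm_mean_nonneg[OF i] m by linarith
  have T0: "T > 0" using T by (cases T) auto
  define q where "q = real n * m"
  \<comment> \<open>This choice makes the Chernoff exponent s^2 n m equal to 2 L, hence the
    probability 2 / T^2, and turns the width 2 s n m into 2 sqrt (2 L n m). The lower bound on n m
    ensures s \<le> 1.\<close>
  define s where "s = sqrt (2 * ?L / q)"
  have q: "800 * ?L \<le> q" "0 < q" using nM T by (auto simp: q_def)
  have s2: "s\<^sup>2 * q = 2 * ?L" using q T by (simp add: s_def)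
  have s: "0 < s" "s \<le> 1" using q T by (auto simp: s_def)
  have sq: "s * q = sqrt (2 * ?L * q)"
  proof (rule real_sqrt_unique[symmetric])
    show "(s * q)\<^sup>2 = 2 * ?L * q" using s2 by (simp add: power2_eq_square mult_ac)
  qed (use s q in auto)
  let ?J = "{i} \<times> {..<n}"
  have card: "card ?J = n" by simp
  have sum_J: "(\<Sum>p\<in>?J. x p) = arm_sum x i n" for x :: "nat \<times> nat \<Rightarrow> real"
    unfolding arm_sum_def by (rule sum.reindex_bij_witness[of _ "\<lambda>j. (i, j)" snd]) auto
  have "measure rewards {x \<in> space rewards. \<bar>(\<Sum>p\<in>?J. x p) - real (card ?J) * arm_mean D i\<bar> > 2 * s * real (card ?J) * m}
    \<le> 2 * exp (- (s\<^sup>2 * real (card ?J) * m))"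
    by (rule chernoff_PiM[where f = "\<lambda>y. y"])
      (use i n s m m0 prob_space_arm id_measurable_arm AE_arm in \<open>auto simp: arm_mean_def\<close>)
  also have "exp (- (s\<^sup>2 * real (card ?J) * m)) = 1 / (real T)\<^sup>2"
    using s2 T0 by (simp add: q_def card mult.assoc exp_minus exp_of_nat_mult[of 2 ?L, simplified] inverse_eq_divide)
  also have "2 * s * real (card ?J) * m = 2 * sqrt (2 * ?L * (real n * m))"
    using sq by (simp add: q_def card mult.assoc)
  finally show ?thesis by (simp add: sum_J)
qed

text \<open>Chernoff with s = 1/4 and m = 1/k: the width is r / (2 k) and the exponent r / (16 k)
  \<ge> 100 L, more than the required 2 L.\<close>

lemma prob_draws_deviation:
  assumes i: "i < k" and r: "r \<le> T" and T: "ln (real T) \<ge> 1" and large: "1600 * real k * ln (real T) \<le> real r"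
  shows "measure explore {u \<in> space explore. \<bar>real (draws u i r) - real r / real k\<bar> > real r / (2 * real k)}
    \<le> 2 / (real T)\<^sup>2"
proof -
  let ?L = "ln (real T)"
  have T0: "T > 0" using T by (cases T) auto
  have mean: "(\<integral>a. indicator {i} a \<partial>measure_pmf (pmf_of_set {..<k})) = 1 / real k"
    using k i by (simp add: measure_pmf_single pmf_of_set lessThan_empty_iff)
  have "measure explore {u \<in> space explore. \<bar>(\<Sum>s\<in>{1..r}. indicator {i} (u s)) - real (card {1..r}) * (1 / real k)\<bar>
      > 2 * (1/4) * real (card {1..r}) * (1 / real k)}
    \<le> 2 * exp (- ((1/4)\<^sup>2 * real (card {1..r}) * (1 / real k)))"
    by (rule chernoff_PiM[where f = "indicator {i}"])
      (use k r mean in \<open>auto simp: prob_space_measure_pmf indicator_def\<close>)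
  also have "\<dots> \<le> 2 * exp (- (2 * ?L))"
    using large k T by (simp add: field_simps power2_eq_square)
  also have "exp (- (2 * ?L)) = 1 / (real T)\<^sup>2"
    using T0 by (simp add: exp_minus exp_of_nat_mult[of 2 ?L, simplified] inverse_eq_divide)
  finally show ?thesis by (simp only: sum_indicator_eq_draws) simp
qed

text \<open>Two families of at most k T deviation events, each of probability at most 2 / T^2, cost
  4 k / T in total. All of them concern the table or the draws, not the adaptive history.\<close>

lemma good_event:
  assumes T: "ln (real T) \<ge> 1" and M: "0 < M" "\<And>i. i < k \<Longrightarrow> arm_mean D i \<le> M"
  obtains G where "G \<in> sets (bandit_space k T D)"
    "measure (bandit_space k T D) G \<ge> 1 - 4 * real k / real T"
    "\<And>x u i j. (x, u) \<in> G \<Longrightarrow> i < k \<Longrightarrow> j < T \<Longrightarrow> 0 \<le> x (i, j) \<and> x (i, j) \<le> 1"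
    "\<And>x u t. (x, u) \<in> G \<Longrightarrow> t \<in> {1..T} \<Longrightarrow> u t < k"
    "\<And>x u i r. (x, u) \<in> G \<Longrightarrow> i < k \<Longrightarrow> r \<le> T \<Longrightarrow> 1600 * real k * ln (real T) \<le> real r \<Longrightarrow>
         \<bar>real (draws u i r) - real r / real k\<bar> \<le> real r / (2 * real k)"
    "\<And>x u i n. (x, u) \<in> G \<Longrightarrow> i < k \<Longrightarrow> n \<le> T \<Longrightarrow> 800 * ln (real T) \<le> real n * M \<Longrightarrow>
         \<bar>arm_sum x i n - real n * arm_mean D i\<bar> \<le> 2 * sqrt (2 * ln (real T) * (real n * M))"
proof -
  let ?B = "bandit_space k T D" and ?L = "ln (real T)"
  interpret prob_space ?B by (rule prob_space_bandit)
  have T0: "T > 0" using T by (cases T) auto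
  define badx where "badx = (\<lambda>(i, n). {x \<in> space rewards.
    \<bar>arm_sum x i n - real n * arm_mean D i\<bar> > 2 * sqrt (2 * ?L * (real n * M))})"
  define badu where "badu = (\<lambda>(i, r). {u \<in> space explore.
    \<bar>real (draws u i r) - real r / real k\<bar> > real r / (2 * real k)})"
  \<comment> \<open>Count 0 is left out, so that there are at most k T pairs; the deviation is 0
    there.\<close>
  define IX where "IX = {(i, n). i < k \<and> n \<in> {1..T} \<and> 800 * ?L \<le> real n * M}"
  define IU where "IU = {(i, r). i < k \<and> r \<in> {1..T} \<and> 1600 * real k * ?L \<le> real r}"
  have sub: "IX \<subseteq> {..<k} \<times> {1..T}" "IU \<subseteq> {..<k} \<times> {1..T}" by (auto simp: IX_def IU_def)
  have fin: "finite IX" "finite IU" using sub by (auto intro: finite_subset)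
  have card: "card IX \<le> k * T" "card IU \<le> k * T"
    using card_mono[OF _ sub(1)] card_mono[OF _ sub(2)] by auto
  define BX where "BX p = fst -` badx p \<inter> space ?B" for p
  define BU where "BU p = snd -` badu p \<inter> space ?B" for p
  have sx: "badx p \<in> sets rewards" if pI: "p \<in> IX" for p
  proof -
    obtain i n where p: "p = (i, n)" and i: "i < k" "n \<le> T" using pI by (auto simp: IX_def)
    have "(\<lambda>x. x (i, j)) \<in> borel_measurable rewards" if "j < n" for j
    proof (rule measurable_compose[OF measurable_component_singleton])
      show "(i, j) \<in> {..<k} \<times> {..<T}" using i that by auto
      show "(\<lambda>y. y) \<in> borel_measurable (D (fst (i, j)))" using i id_measurable_arm by simp
    qed
    then have [measurable]: "(\<lambda>x. arm_sum x i n) \<in> borel_measurable rewards"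
      unfolding arm_sum_def by (intro borel_measurable_sum) auto
    show ?thesis unfolding p badx_def by simp
  qed
  have su: "badu p \<in> sets explore" if pI: "p \<in> IU" for p
  proof -
    obtain i r where p: "p = (i, r)" and i: "i < k" "r \<le> T" using pI by (auto simp: IU_def)
    have "(\<lambda>u. indicator {i} (u s)) \<in> borel_measurable explore" if "s \<in> {1..r}" for s
      by (rule measurable_compose[OF measurable_component_singleton]) (use that i in auto)
    then have "(\<lambda>u. \<Sum>s=1..r. indicator {i} (u s) :: real) \<in> borel_measurable explore"
      by (intro borel_measurable_sum) auto
    then have [measurable]: "(\<lambda>u. real (draws u i r)) \<in> borel_measurable explore"
      by (simp only: sum_indicator_eq_draws)
    show ?thesis unfolding p badu_def prod.case by measurable
  qed
  have BX: "BX p \<in> sets ?B" "prob (BX p) \<le> 2 / (real T)\<^sup>2" if "p \<in> IX" for p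
  proof -
    show "BX p \<in> sets ?B" unfolding BX_def using measurable_bandit_fst sx[OF that] by (rule measurable_sets)
    have "prob (BX p) = measure (distr ?B rewards fst) (badx p)"
      unfolding BX_def by (rule measure_distr[OF measurable_bandit_fst sx[OF that], symmetric])
    also have "\<dots> = measure rewards (badx p)"
      by (simp only: distr_bandit_fst)
    also have "\<dots> \<le> 2 / (real T)\<^sup>2"
      using that T M(2) by (auto simp: IX_def badx_def intro!: prob_rewards_deviation)
    finally show "prob (BX p) \<le> 2 / (real T)\<^sup>2" .
  qed
  have BU: "BU p \<in> sets ?B" "prob (BU p) \<le> 2 / (real T)\<^sup>2" if "p \<in> IU" for p
  proof -
    show "BU p \<in> sets ?B" unfolding BU_def using measurable_bandit_snd su[OF that] by (rule measurable_sets)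
    have "prob (BU p) = measure (distr ?B explore snd) (badu p)"
      unfolding BU_def by (rule measure_distr[OF measurable_bandit_snd su[OF that], symmetric])
    also have "\<dots> = measure explore (badu p)"
      by (simp only: distr_bandit_snd)
    also have "\<dots> \<le> 2 / (real T)\<^sup>2"
      using that T by (auto simp: IU_def badu_def simp del: One_nat_def intro!: prob_draws_deviation)
    finally show "prob (BU p) \<le> 2 / (real T)\<^sup>2" .
  qed
  define bad where "bad = (\<Union>p\<in>IX. BX p) \<union> (\<Union>p\<in>IU. BU p)"
  have bad: "bad \<in> sets ?B" unfolding bad_def using BX(1) BU(1) fin by (intro sets.Un sets.finite_UN) auto
  have union: "prob (\<Union>p\<in>I. F p) \<le> real (k * T) * (2 / (real T)\<^sup>2)"
    if "finite I" "card I \<le> k * T" "\<And>p. p \<in> I \<Longrightarrow> F p \<in> sets ?B" "\<And>p. p \<in> I \<Longrightarrow> prob (F p) \<le> 2 / (real T)\<^sup>2"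
    for I :: "(nat \<times> nat) set" and F
  proof -
    have "prob (\<Union>p\<in>I. F p) \<le> (\<Sum>p\<in>I. prob (F p))" using that by (intro measure_UNION_le) auto
    also have "\<dots> \<le> real (card I) * (2 / (real T)\<^sup>2)" using that(4) by (rule sum_bounded_above)
    also have "\<dots> \<le> real (k * T) * (2 / (real T)\<^sup>2)" using that(2)
      by (intro mult_right_mono of_nat_mono) auto
    finally show ?thesis .
  qed
  have "prob bad \<le> prob (\<Union>p\<in>IX. BX p) + prob (\<Union>p\<in>IU. BU p)"
    unfolding bad_def using BX(1) BU(1) fin by (intro measure_Un_le sets.finite_UN) auto
  also have "\<dots> \<le> real (k * T) * (2 / (real T)\<^sup>2) + real (k * T) * (2 / (real T)\<^sup>2)"
    using BX BU fin card by (intro add_mono union) auto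
  also have "\<dots> = 4 * real k / real T" using T0 by (simp add: power2_eq_square field_simps)
  finally have pbad: "prob bad \<le> 4 * real k / real T" .
  obtain N where N: "N \<in> null_sets ?B" and sure: "\<And>\<omega>. \<omega> \<in> space ?B - N \<Longrightarrow>
    (\<forall>p\<in>{..<k} \<times> {..<T}. 0 \<le> fst \<omega> p \<and> fst \<omega> p \<le> 1) \<and> (\<forall>t\<in>{1..T}. snd \<omega> t < k)"
    using AE_E3[OF AE_bandit] by blast
  \<comment> \<open>Removing a null set makes the almost sure range conditions hold at every point
    of \<open>G\<close>, as the pathwise locales require.\<close>
  define G where "G = space ?B - bad - N"
  have G: "G \<in> sets ?B" unfolding G_def using bad N by auto
  have "prob G = prob (space ?B - bad)"
    unfolding G_def using N bad by (intro measure_Diff_null_set) auto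
  also have "\<dots> = 1 - prob bad" using bad by (rule prob_compl)
  finally have pG: "prob G \<ge> 1 - 4 * real k / real T" using pbad by simp
  show ?thesis
  proof (rule that[OF G pG])
    fix x u assume \<omega>: "(x, u) \<in> G"
    then have sp: "x \<in> space rewards" "u \<in> space explore" "(x, u) \<in> space ?B"
      by (auto simp: G_def bandit_space_def space_pair_measure)
    have s: "(\<forall>p\<in>{..<k} \<times> {..<T}. 0 \<le> x p \<and> x p \<le> 1) \<and> (\<forall>t\<in>{1..T}. u t < k)"
      using sure[of "(x, u)"] \<omega> by (auto simp: G_def)
    show "0 \<le> x (i, j) \<and> x (i, j) \<le> 1" if "i < k" "j < T" for i j using s that by auto
    show "u t < k" if "t \<in> {1..T}" for t using s that by auto
    show "\<bar>real (draws u i r) - real r / real k\<bar> \<le> real r / (2 * real k)"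
      if "i < k" "r \<le> T" "1600 * real k * ?L \<le> real r" for i r
    proof (rule ccontr)
      assume c: "\<not> ?thesis"
      then have "r \<noteq> 0" by (intro notI) auto
      then have "(i, r) \<in> IU" using that by (auto simp: IU_def)
      moreover have "(x, u) \<in> BU (i, r)" using sp c by (auto simp: BU_def badu_def)
      ultimately show False using \<omega> by (auto simp: G_def bad_def)
    qed
    show "\<bar>arm_sum x i n - real n * arm_mean D i\<bar> \<le> 2 * sqrt (2 * ?L * (real n * M))"
      if "i < k" "n \<le> T" "800 * ?L \<le> real n * M" for i n
    proof (rule ccontr)
      assume c: "\<not> ?thesis"
      then have "n \<noteq> 0" by (intro notI) (auto simp: arm_sum_def)
      then have "(i, n) \<in> IX" using that by (auto simp: IX_def)
      moreover have "(x, u) \<in> BX (i, n)" using sp c by (auto simp: BX_def badx_def)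
      ultimately show False using \<omega> by (auto simp: G_def bad_def)
    qed
  qed
qed

end

subsection \<open>Expected welfare and Nash regret\<close>

text \<open>The product (4 y - 1) (1 - y) \<ge> 0 rearranges to 1 \<le> y (1 + 4 (1 - y)), and 1 + z
  \<le> exp z finishes.\<close>

lemma exp_le_of_ge_quarter:
  fixes y :: real
  assumes "1/4 \<le> y" "y \<le> 1"
  shows "exp (- (4 * (1 - y))) \<le> y"
proof -
  have "0 \<le> (4 * y - 1) * (1 - y)" using assms by (intro mult_nonneg_nonneg) auto
  then have "1 \<le> y * (1 + 4 * (1 - y))" by (simp add: algebra_simps)
  also have "\<dots> \<le> y * exp (4 * (1 - y))"
    using assms by (intro mult_left_mono exp_ge_add_one_self) auto
  finally show ?thesis by (subst exp_minus) (simp add: inverse_eq_divide divide_le_eq)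
qed

text \<open>Each factor is at least M exp (- a t), so the geometric mean is at least M exp (- A)
  \<ge> M (1 - A) for the average A of the losses \<open>a t\<close>. An early round loses ln K, a
  late one four times its relative gap.\<close>

lemma geometric_mean_ge:
  fixes p :: "nat \<Rightarrow> real"
  assumes T: "T > 0" and M: "M > 0" and K: "K > 0" and R: "R \<le> T"
    and low: "\<And>t. t \<in> {1..R} \<Longrightarrow> M / K \<le> p t"
    and high: "\<And>t. t \<in> {R<..T} \<Longrightarrow> M / 4 \<le> p t \<and> p t \<le> M"
  shows "M - (M * real R * ln K + 4 * (\<Sum>t\<in>{R<..T}. M - p t)) / real T \<le> root T (\<Prod>t\<in>{1..T}. p t)"
proof -
  define a where "a t = (if t \<le> R then ln K else 4 * (1 - p t / M))" for t
  have pa: "M * exp (- a t) \<le> p t" if t: "t \<in> {1..T}" for t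
  proof (cases "t \<le> R")
    case True
    then show ?thesis using low[of t] t K by (simp add: a_def exp_minus inverse_eq_divide)
  next
    case False
    then have "M / 4 \<le> p t" "p t \<le> M" using high[of t] t by auto
    then have "exp (- (4 * (1 - p t / M))) \<le> p t / M"
      using M by (intro exp_le_of_ge_quarter) (auto simp: field_simps)
    then show ?thesis using False M by (simp add: a_def field_simps)
  qed
  have split: "{1..T} = {1..R} \<union> {R<..T}" using R by auto
  have "(\<Sum>t\<in>{1..T}. a t) = (\<Sum>t\<in>{1..R}. a t) + (\<Sum>t\<in>{R<..T}. a t)"
    unfolding split by (rule sum.union_disjoint) auto
  also have "(\<Sum>t\<in>{1..R}. a t) = real R * ln K" by (simp add: a_def)
  also have "(\<Sum>t\<in>{R<..T}. a t) = (\<Sum>t\<in>{R<..T}. 4 / M * (M - p t))"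
    using M by (intro sum.cong) (auto simp: a_def field_simps)
  finally have sa: "(\<Sum>t\<in>{1..T}. a t) = real R * ln K + 4 / M * (\<Sum>t\<in>{R<..T}. M - p t)"
    by (simp add: sum_distrib_left)
  let ?A = "(\<Sum>t\<in>{1..T}. a t) / real T"
  have "(M * exp (- ?A)) ^ T = (\<Prod>t\<in>{1..T}. M * exp (- a t))"
  proof -
    have "exp (- ?A) ^ T = exp (- (\<Sum>t\<in>{1..T}. a t))"
      using T by (simp add: exp_of_nat_mult[symmetric])
    also have "\<dots> = (\<Prod>t\<in>{1..T}. exp (- a t))"
      by (simp add: exp_sum[symmetric] sum_negf)
    finally show ?thesis by (simp add: power_mult_distrib prod.distrib)
  qed
  also have "\<dots> \<le> (\<Prod>t\<in>{1..T}. p t)"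
    using pa M by (intro prod_mono) auto
  finally have "root T ((M * exp (- ?A)) ^ T) \<le> root T (\<Prod>t\<in>{1..T}. p t)"
    using T by (simp only: real_root_le_iff)
  then have "M * exp (- ?A) \<le> root T (\<Prod>t\<in>{1..T}. p t)"
    using T M by (simp add: real_root_power_cancel)
  moreover have "M * (1 - ?A) \<le> M * exp (- ?A)"
    using M exp_ge_add_one_self[of "- ?A"] by (intro mult_left_mono) auto
  moreover have "M * (1 - ?A) = M - (M * real R * ln K + 4 * (\<Sum>t\<in>{R<..T}. M - p t)) / real T"
    unfolding sa using M T by (simp add: field_simps)
  ultimately show ?thesis by simp
qed

text \<open>In order: L \<ge> 1; failure probability 4 k / T at most 1 / (2 k); phase 1 fits into
  the horizon when M > sqrt (k L / T); lower-order terms fit into one multiple of sqrt (k L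
  T).\<close>

lemma eventually_horizon_large:
  assumes "k \<ge> (1::nat)"
  shows "\<forall>\<^sub>F T::nat in sequentially. ln (real T) \<ge> 1 \<and> real T \<ge> 8 * real k ^ 2
    \<and> 10000 * sqrt (real k * ln (real T) * real T) + 1 \<le> real T
    \<and> (10000 * real k * ln (real T) + 1) * ln (4 * real k) + 16 * real k \<le> sqrt (real k * ln (real T) * real T)"
proof -
  define K where "K = real k"
  define c where "c = ln (4 * K)"
  have K: "K > 0" using assms by (simp add: K_def)
  have c: "c > 0" using assms by (simp add: c_def K_def)
  have "\<forall>\<^sub>F T::nat in sequentially. ln (real T) \<ge> 1" by real_asymp
  moreover have "\<forall>\<^sub>F T::nat in sequentially. real T \<ge> 8 * K ^ 2" by real_asymp
  moreover have "\<forall>\<^sub>F T::nat in sequentially. 10000 * sqrt (K * ln (real T) * real T) + 1 \<le> real T"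
    using K by real_asymp
  moreover have "\<forall>\<^sub>F T::nat in sequentially. (10000 * K * ln (real T) + 1) * c + 16 * K \<le> sqrt (K * ln (real T) * real T)"
    using K c by real_asymp
  ultimately show ?thesis unfolding K_def[symmetric] c_def[symmetric]
    by eventually_elim auto
qed

section \<open>Bounds on the expected mean in each round, and the regret\<close>

context
  fixes k T :: nat and D :: "nat \<Rightarrow> real measure" and v :: "hist \<Rightarrow> nat \<Rightarrow> real" and sel :: "hist \<Rightarrow> nat"
  assumes k: "k \<ge> 1" and valid: "valid_instance k D" and sel: "ncb_selector k T v sel"
    and meas: "\<And>t. t \<in> {1..T} \<Longrightarrow> arm_at k T v sel t \<in> measurable (bandit_space k T D) (count_space UNIV)"
begin

abbreviation welfare :: "nat \<Rightarrow> real" where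
  "welfare t \<equiv> \<integral>\<omega>. arm_mean D (arm_at k T v sel t \<omega>) \<partial>bandit_space k T D"

lemma arm_mean_le_mu_star: "i < k \<Longrightarrow> arm_mean D i \<le> mu_star k D"
  unfolding mu_star_def by (rule Max_ge) auto

lemma best_arm: obtains b where "b < k" "arm_mean D b = mu_star k D"
proof -
  have "mu_star k D \<in> arm_mean D ` {..<k}"
    unfolding mu_star_def using k by (intro Max_in) (auto simp: lessThan_empty_iff)
  then show ?thesis using that by auto
qed

lemma AE_arm_mean: "AE \<omega> in bandit_space k T D. \<forall>t\<in>{1..T}.
    0 \<le> arm_mean D (arm_at k T v sel t \<omega>) \<and> arm_mean D (arm_at k T v sel t \<omega>) \<le> mu_star k D"
  using AE_bandit[OF k valid, of T]
proof eventually_elim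
  case (elim \<omega>)
  interpret ncb_run k T v sel "fst \<omega>" "snd \<omega>"
    by standard (use k sel elim in auto)
  show ?case
    using arm_less arm_mean_nonneg[OF k valid] arm_mean_le_mu_star by simp
qed

text \<open>\<open>sel\<close> and \<open>v\<close> are arbitrary functions of the history, so
  measurability comes from the assumption \<open>meas\<close>. The integral of a non-measurable
  function would be 0 by default.\<close>

lemma measurable_arm_mean:
  "t \<in> {1..T} \<Longrightarrow> (\<lambda>\<omega>. arm_mean D (arm_at k T v sel t \<omega>)) \<in> borel_measurable (bandit_space k T D)"
  by (rule measurable_compose[OF meas]) auto

lemma integrable_arm_mean:
  assumes t: "t \<in> {1..T}"
  shows "integrable (bandit_space k T D) (\<lambda>\<omega>. arm_mean D (arm_at k T v sel t \<omega>))"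
proof -
  interpret prob_space "bandit_space k T D" by (rule prob_space_bandit[OF k valid])
  show ?thesis
    using AE_arm_mean t measurable_arm_mean[OF t]
    by (intro integrable_const_bound[where B = "mu_star k D"]) (auto elim: eventually_mono)
qed

lemma welfare_nonneg: "t \<in> {1..T} \<Longrightarrow> 0 \<le> welfare t"
  by (rule integral_nonneg_AE) (use AE_arm_mean in \<open>auto elim: eventually_mono\<close>)

lemma welfare_le:
  assumes t: "t \<in> {1..T}"
  shows "welfare t \<le> mu_star k D"
proof -
  interpret prob_space "bandit_space k T D" by (rule prob_space_bandit[OF k valid])
  show ?thesis using AE_arm_mean t
    by (intro integral_le_const integrable_arm_mean) (auto elim: eventually_mono)
qed

lemma welfare_ge:
  assumes t: "t \<in> {1..T}" and A: "A \<in> sets (bandit_space k T D)"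
    and ge: "\<And>\<omega>. \<omega> \<in> A \<Longrightarrow> c \<le> arm_mean D (arm_at k T v sel t \<omega>)"
  shows "c * measure (bandit_space k T D) A \<le> welfare t"
proof -
  interpret prob_space "bandit_space k T D" by (rule prob_space_bandit[OF k valid])
  have "c * prob A = expectation (\<lambda>\<omega>. c * indicator A \<omega>)" using A by simp
  also have "\<dots> \<le> welfare t"
  proof (intro integral_mono_AE integrable_arm_mean t)
    show "AE \<omega> in bandit_space k T D. c * indicator A \<omega> \<le> arm_mean D (arm_at k T v sel t \<omega>)"
      using AE_arm_mean by eventually_elim (use t ge in \<open>auto simp: indicator_def\<close>)
  qed (use A in \<open>auto intro!: integrable_mult_right integrable_real_indicator emeasure_finite simp: less_top[symmetric]\<close>)
  finally show ?thesis .
qed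

lemma welfare_bounds:
  fixes M :: real and R' :: nat
  defines "M \<equiv> mu_star k D" and "R' \<equiv> nat \<lceil>10000 * real k * ln (real T) / mu_star k D\<rceil>"
  assumes T: "ln (real T) \<ge> 1" "real T \<ge> 8 * real k ^ 2" and M0: "0 < M" and R': "R' \<le> T"
  shows "\<And>t. t \<in> {1..T} \<Longrightarrow> M / (4 * real k) \<le> welfare t"
    and "\<And>t. t \<in> {R'<..T} \<Longrightarrow> M / 4 \<le> welfare t"
    and "(\<Sum>t\<in>{R'<..T}. M - welfare t) \<le> 60 * sqrt (ln (real T) * M * (real k * real T)) + 4 * real k * M"
proof -
  let ?B = "bandit_space k T D"
  let ?Z = "\<lambda>t \<omega>. arm_mean D (arm_at k T v sel t \<omega>)"
  interpret prob_space ?B by (rule prob_space_bandit[OF k valid])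
  obtain b where b: "b < k" "arm_mean D b = M" using best_arm M_def by auto
  have M1: "M \<le> 1" using arm_mean_le_1[OF k valid b(1)] b(2) by simp
  obtain G where G: "G \<in> sets ?B" and pG: "prob G \<ge> 1 - 4 * real k / real T"
    and run: "\<And>x u i j. (x, u) \<in> G \<Longrightarrow> i < k \<Longrightarrow> j < T \<Longrightarrow> 0 \<le> x (i, j) \<and> x (i, j) \<le> 1"
    "\<And>x u t. (x, u) \<in> G \<Longrightarrow> t \<in> {1..T} \<Longrightarrow> u t < k"
    "\<And>x u i r. (x, u) \<in> G \<Longrightarrow> i < k \<Longrightarrow> r \<le> T \<Longrightarrow> 1600 * real k * ln (real T) \<le> real r \<Longrightarrow>
         \<bar>real (draws u i r) - real r / real k\<bar> \<le> real r / (2 * real k)"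
    "\<And>x u i n. (x, u) \<in> G \<Longrightarrow> i < k \<Longrightarrow> n \<le> T \<Longrightarrow> 800 * ln (real T) \<le> real n * M \<Longrightarrow>
         \<bar>arm_sum x i n - real n * arm_mean D i\<bar> \<le> 2 * sqrt (2 * ln (real T) * (real n * M))"
    using good_event[OF k valid T(1) M0] arm_mean_le_mu_star unfolding M_def by blast
  have good: "good_run k T v sel (fst \<omega>) (snd \<omega>) (arm_mean D) M b
      (nat \<lceil>1600 * real k * ln (real T) / M\<rceil>) R'" if "\<omega> \<in> G" for \<omega>
  proof -
    have \<omega>: "(fst \<omega>, snd \<omega>) \<in> G" using that by simp
    show ?thesis
      by unfold_locales
        (use k sel T(1) b M0 M1 R' run(1)[OF \<omega>] run(2)[OF \<omega>] run(3)[OF \<omega>] run(4)[OF \<omega>] arm_mean_le_mu_star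
          in \<open>auto simp: M_def R'_def\<close>)
  qed
  have T0: "real T > 0" using T by (cases T) auto
  have k1: "real k \<ge> 1" using k by simp
  have loss: "4 * real k / real T \<le> 1 / (2 * real k)"
    using T(2) T0 k1 by (simp add: field_simps power2_eq_square)
  have loss': "1 / (2 * real k) \<le> 1 / 2" using k1 by (simp add: field_simps)
  show "M / (4 * real k) \<le> welfare t" if t: "t \<in> {1..T}" for t
  proof -
    let ?U = "{\<omega> \<in> space ?B. snd \<omega> t = b}"
    note U = prob_draw[OF k valid t b(1)]
    \<comment> \<open>\<open>G\<close> and the draw in round \<open>t\<close> need not be
      independent, so the failure probability is subtracted: 1/k - 1/(2 k) = 1/(2 k)
      remains.\<close>
    have "prob ?U \<le> prob ((G \<inter> ?U) \<union> (space ?B - G))"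
      using G U(1) by (intro finite_measure_mono) auto
    also have "\<dots> \<le> prob (G \<inter> ?U) + prob (space ?B - G)"
      using G U(1) by (intro measure_Un_le) auto
    finally have "1 / real k \<le> prob (G \<inter> ?U) + 4 * real k / real T"
      using pG U(2) prob_compl[OF G] by simp
    then have "1 / (2 * real k) \<le> prob (G \<inter> ?U)" using loss by (simp add: field_simps)
    then have "M / 2 * (1 / (2 * real k)) \<le> M / 2 * prob (G \<inter> ?U)"
      using M0 by (intro mult_left_mono) auto
    also have "\<dots> \<le> welfare t"
    proof (rule welfare_ge[OF t])
      fix \<omega> assume \<omega>: "\<omega> \<in> G \<inter> ?U"
      then interpret good_run k T v sel "fst \<omega>" "snd \<omega>" "arm_mean D" M b
        "nat \<lceil>1600 * real k * ln (real T) / M\<rceil>" R' by (intro good) auto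
      show "M / 2 \<le> ?Z t \<omega>" using mean_ge_if_draw_best[OF t] \<omega> by simp
    qed (use G U(1) in auto)
    finally show ?thesis by simp
  qed
  show "M / 4 \<le> welfare t" if t: "t \<in> {R'<..T}" for t
  proof -
    have "1 / 2 \<le> prob G" using pG loss loss' by linarith
    then have "M / 2 * (1 / 2) \<le> M / 2 * prob G" using M0 by (intro mult_left_mono) auto
    also have "\<dots> \<le> welfare t"
    proof (rule welfare_ge[OF _ G])
      fix \<omega> assume \<omega>: "\<omega> \<in> G"
      then interpret good_run k T v sel "fst \<omega>" "snd \<omega>" "arm_mean D" M b
        "nat \<lceil>1600 * real k * ln (real T) / M\<rceil>" R' by (rule good)
      show "M / 2 \<le> ?Z t \<omega>" using mean_ge_after_R'[OF t] by simp
    qed (use t in auto)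
    finally show ?thesis by simp
  qed
  let ?S = "60 * sqrt (ln (real T) * M * (real k * real T))"
  have S0: "?S \<ge> 0" using T M0 by simp
  have compl: "space ?B - G \<in> sets ?B" using G by auto
  have int: "integrable ?B (?Z t)" if "t \<in> {R'<..T}" for t
    using that by (intro integrable_arm_mean) auto
  have "(\<Sum>t\<in>{R'<..T}. M - welfare t) = (\<Sum>t\<in>{R'<..T}. expectation (\<lambda>\<omega>. M - ?Z t \<omega>))"
    using int by (intro sum.cong) (auto simp: prob_space)
  also have "\<dots> = expectation (\<lambda>\<omega>. \<Sum>t\<in>{R'<..T}. M - ?Z t \<omega>)"
    using int by (intro Bochner_Integration.integral_sum[symmetric]) auto
  \<comment> \<open>Off \<open>G\<close> the total gap is at most T M; the failure probability 4 k /
    T turns this into 4 k M.\<close>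
  also have "\<dots> \<le> expectation (\<lambda>\<omega>. ?S + real T * M * indicator (space ?B - G) \<omega>)"
  proof (rule integral_mono_AE)
    show "integrable ?B (\<lambda>\<omega>. \<Sum>t\<in>{R'<..T}. M - ?Z t \<omega>)" using int by auto
    show "integrable ?B (\<lambda>\<omega>. ?S + real T * M * indicator (space ?B - G) \<omega>)"
      using compl by (intro Bochner_Integration.integrable_add integrable_mult_right integrable_real_indicator)
        (auto simp: less_top[symmetric])
    show "AE \<omega> in ?B. (\<Sum>t\<in>{R'<..T}. M - ?Z t \<omega>) \<le> ?S + real T * M * indicator (space ?B - G) \<omega>"
      using AE_arm_mean AE_space
    proof eventually_elim
      case (elim \<omega>)
      show ?case
      proof (cases "\<omega> \<in> G")
        case True
        then interpret good_run k T v sel "fst \<omega>" "snd \<omega>" "arm_mean D" M b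
          "nat \<lceil>1600 * real k * ln (real T) / M\<rceil>" R' by (rule good)
        show ?thesis using sum_gap_le True by simp
      next
        case False
        have "(\<Sum>t\<in>{R'<..T}. M - ?Z t \<omega>) \<le> (\<Sum>t\<in>{R'<..T}. M)"
          using elim by (intro sum_mono) auto
        also have "\<dots> \<le> real T * M" using M0 by simp
        finally have "(\<Sum>t\<in>{R'<..T}. M - ?Z t \<omega>) \<le> ?S + real T * M" using S0 by linarith
        then show ?thesis using False elim by simp
      qed
    qed
  qed
  also have "\<dots> = ?S + real T * M * prob (space ?B - G)"
    using compl by (subst Bochner_Integration.integral_add) (auto simp: prob_space less_top[symmetric])
  also have "\<dots> \<le> ?S + real T * M * (4 * real k / real T)"
    using pG prob_compl[OF G] M0 by (intro add_left_mono mult_left_mono) auto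
  also have "\<dots> = ?S + 4 * real k * M" using T0 by simp
  finally show "(\<Sum>t\<in>{R'<..T}. M - welfare t) \<le> ?S + 4 * real k * M" .
qed

lemma nash_regret_le:
  assumes T: "ln (real T) \<ge> 1" "real T \<ge> 8 * real k ^ 2"
    "10000 * sqrt (real k * ln (real T) * real T) + 1 \<le> real T"
    "(10000 * real k * ln (real T) + 1) * ln (4 * real k) + 16 * real k \<le> sqrt (real k * ln (real T) * real T)"
  shows "nash_regret k T D v sel \<le> 241 * sqrt (real k * ln (real T) / real T)"
proof -
  define M where "M = mu_star k D"
  define L where "L = ln (real T)"
  define r where "r = sqrt (real k * L / real T)"
  have L: "L \<ge> 1" using T by (simp add: L_def)
  have T0: "T > 0" "real T > 0" using T by (cases T; auto)+
  have k1: "real k \<ge> 1" using k by simp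
  have r0: "r > 0" using L k1 T0 by (simp add: r_def)
  have rT: "sqrt (real k * L * real T) = r * real T"
  proof -
    have "real k * L * real T = real k * L / real T * (real T)\<^sup>2"
      using T0 by (simp add: power2_eq_square)
    then show ?thesis using T0 by (simp only: r_def real_sqrt_mult real_sqrt_abs)
  qed
  have regret: "nash_regret k T D v sel = M - root T (\<Prod>t\<in>{1..T}. welfare t)"
    by (simp add: nash_regret_def M_def)
  show ?thesis
  proof (cases "M \<le> r")
    \<comment> \<open>The expected means are nonnegative, so the regret is at most
      \<open>M\<close>.\<close>
    case True
    have "0 \<le> root T (\<Prod>t\<in>{1..T}. welfare t)"
      by (intro real_root_ge_zero prod_nonneg welfare_nonneg ballI)
    then have "nash_regret k T D v sel \<le> r" using regret True by linarith
    then have "nash_regret k T D v sel \<le> 241 * r" using r0 by linarith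
    then show ?thesis by (simp add: r_def L_def)
  next
    case False
    then have M0: "M > 0" using r0 by simp
    obtain b where b: "b < k" "arm_mean D b = M" using best_arm M_def by auto
    have M1: "M \<le> 1" using arm_mean_le_1[OF k valid b(1)] b(2) by simp
    define R where "R = nat \<lceil>10000 * real k * L / M\<rceil>"
    have R_le: "real R \<le> 10000 * real k * L / M + 1"
      unfolding R_def using L M0 k1 by (simp add: of_nat_nat)
    \<comment> \<open>Since M > r and k L = r^2 T, the length bound k L / M is at most r T, and the
      third horizon condition yields R \<le> T.\<close>
    have "10000 * real k * L / M \<le> 10000 * real k * L / r"
      using False r0 L k1 by (intro divide_left_mono) auto
    also have "10000 * real k * L / r = 10000 * (r * real T)"
    proof -
      have "r * r = real k * L / real T" using L k1 T0 by (simp add: r_def)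
      then have "real k * L = r * real T * r" using T0 by (simp add: field_simps)
      then show ?thesis using r0 by (simp add: field_simps)
    qed
    finally have "real R \<le> real T" using R_le T(3) rT by (simp add: L_def)
    then have RT: "R \<le> T" by simp
    note W = welfare_bounds[OF T(1,2) M0[unfolded M_def] RT[unfolded R_def M_def L_def],
      folded M_def L_def, folded R_def]
    have "M - (M * real R * ln (4 * real k) + 4 * (\<Sum>t\<in>{R<..T}. M - welfare t)) / real T \<le> root T (\<Prod>t\<in>{1..T}. welfare t)"
      using W welfare_le M0 k1 RT T0 by (intro geometric_mean_ge) (auto simp: M_def)
    then have "nash_regret k T D v sel \<le> (M * real R * ln (4 * real k) + 4 * (\<Sum>t\<in>{R<..T}. M - welfare t)) / real T"
      using regret by linarith
    \<comment> \<open>The factor \<open>M\<close> cancels the 1 / M in \<open>R\<close>; elsewhere M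
      \<le> 1 is used.\<close>
    also have "\<dots> \<le> ((10000 * real k * L + 1) * ln (4 * real k) + 4 * (60 * (r * real T) + 4 * real k)) / real T"
    proof (intro divide_right_mono add_mono mult_right_mono mult_left_mono)
      have "M * real R \<le> M * (10000 * real k * L / M + 1)"
        using R_le M0 by (intro mult_left_mono) auto
      also have "\<dots> = 10000 * real k * L + M" using M0 by (simp add: field_simps)
      finally show "M * real R \<le> 10000 * real k * L + 1" using M1 by linarith
      have "L * M * (real k * real T) \<le> L * 1 * (real k * real T)"
        using L M1 by (intro mult_right_mono mult_left_mono) auto
      then have "sqrt (L * M * (real k * real T)) \<le> r * real T"
        unfolding rT[symmetric] by (intro real_sqrt_le_mono) (simp add: mult_ac)
      moreover have "4 * real k * M \<le> 4 * real k" using M1 k1 by (simp add: mult_left_le)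
      ultimately show "(\<Sum>t\<in>{R<..T}. M - welfare t) \<le> 60 * (r * real T) + 4 * real k"
        using W(3) by linarith
    qed (use k1 in auto)
    \<comment> \<open>240 = 4 * 60 comes from the gaps; the remaining terms are at most r T by the
      fourth horizon condition.\<close>
    also have "\<dots> \<le> (241 * (r * real T)) / real T"
      using T(4) rT T0 by (intro divide_right_mono) (auto simp: L_def)
    also have "\<dots> = 241 * r" using T0 by simp
    finally show ?thesis by (simp add: r_def L_def)
  qed
qed

end

theorem theorem2:
  shows "\<exists>C>0. \<forall>k::nat. k \<ge> 1 \<longrightarrow> (\<exists>T0::nat. \<forall>T\<ge>T0.
     \<forall>(D::nat \<Rightarrow> real measure) v sel.
       valid_instance k D \<longrightarrow> ncb_selector k T v sel \<longrightarrow>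
       (\<forall>t\<in>{1..T}. arm_at k T v sel t \<in> measurable (bandit_space k T D) (count_space UNIV)) \<longrightarrow>
       nash_regret k T D v sel \<le> C * sqrt (real k * ln (real T) / real T))"
proof (intro exI[of _ "241::real"] conjI allI impI)
  fix k :: nat assume k: "k \<ge> 1"
  \<comment> \<open>The threshold is fixed before \<open>D\<close>, \<open>v\<close> and
    \<open>sel\<close>, so it depends on \<open>k\<close> only.\<close>
  obtain T0 where "\<forall>T\<ge>T0. ln (real T) \<ge> 1 \<and> real T \<ge> 8 * real k ^ 2
    \<and> 10000 * sqrt (real k * ln (real T) * real T) + 1 \<le> real T
    \<and> (10000 * real k * ln (real T) + 1) * ln (4 * real k) + 16 * real k \<le> sqrt (real k * ln (real T) * real T)"
    using eventually_horizon_large[OF k] unfolding eventually_sequentially by blast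
  then show "\<exists>T0::nat. \<forall>T\<ge>T0. \<forall>(D::nat \<Rightarrow> real measure) v sel.
       valid_instance k D \<longrightarrow> ncb_selector k T v sel \<longrightarrow>
       (\<forall>t\<in>{1..T}. arm_at k T v sel t \<in> measurable (bandit_space k T D) (count_space UNIV)) \<longrightarrow>
       nash_regret k T D v sel \<le> 241 * sqrt (real k * ln (real T) / real T)"
    using k by (intro exI[of _ T0] allI impI nash_regret_le) auto
qed simp

end
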